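(* Let $d_1,d_2$ be positive integers and let $\Gamma=\mathrm{Doob}(d_1,d_2)=\Gamma^1\times\Gamma^2\times\dots\times\Gamma^{d_1+d_2}$ be the Doob graph, where $\Gamma^1,\dots,\Gamma^{d_1}$ are copies of the Shrikhande graph and $\Gamma^{d_1+1},\dots,\Gamma^{d_1+d_2}$ are copies of the complete graph $K_4$. Then every descendent $Y$ of $\Gamma$ (with respect to the standard $Q$-polynomial ordering) is of the form $Y=Y^1\times Y^2\times\dots\times Y^{d_1+d_2}$, where for each $i$ $(1\leqslant i\leqslant d_1+d_2)$ either $Y^i$ is the whole vertex set of $\Gamma^i$ or $|Y^i|=1$.
   Context: All graphs are finite, simple and undirected. Let $\Gamma$ be a connected graph with vertex set $X$, path-length distance $\partial$ and diameter $d$; let $A_i\in\mathbb{C}^{X\times X}$ be the adjacency matrix of the distance-$i$ graph ($A_0=I$). $\Gamma$ is distance-regular if there are integers $b_i,c_i$ such that whenever $\partial(x,y)=i$, $y$ has exactly $b_i$ (resp. $c_i$) neighbours at distance $i+1$ (resp. $i-1$) from $x$. Then the Bose--Mesner algebra $\langle A_0,\dots,A_d\rangle$ (complex span) is a commutative semisimple algebra with a basis of primitive idempotents $E_0=|X|^{-1}J,E_1,\dots,E_d$. $\Gamma$ is $Q$-polynomial with respect to the ordering $\{E_i\}_{i=0}^d$ if there are scalars $a_i^*,b_i^*,c_i^*$ with $b_d^*=c_0^*=0$, $b_{i-1}^*c_i^*\neq 0$ $(1\leqslant i\leqslant d)$ and $E_1\circ E_i=|X|^{-1}(b_{i-1}^*E_{i-1}+a_i^*E_i+c_{i+1}^*E_{i+1})$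 $(0\leqslant i\leqslant d)$, where $\circ$ is the entrywise product, $E_{-1}=E_{d+1}=0$, $b_{-1}^*=c_{d+1}^*=0$. Write $|X|E_1=\sum_{i=0}^d\theta_i^*A_i$. For a nonempty $Y\subseteq X$ with characteristic vector $\hat Y$, the width is $w=\max\{i:\hat Y^{\mathsf T}A_i\hat Y\neq 0\}$ and the dual width is $w^*=\max\{i:\hat Y^{\mathsf T}E_i\hat Y\neq 0\}$. One always has $w+w^*\geqslant d$; $Y$ is a descendent of $\Gamma$ if $w+w^*=d$. Put $[i]_q=1+q+\dots+q^{i-1}$. $\Gamma$ has classical parameters $(d,q,\alpha,\beta)$ if $b_i=([d]_q-[i]_q)(\beta-\alpha[i]_q)$ and $c_i=[i]_q(1+\alpha[i-1]_q)$ for $0\leqslant i\leqslant d$. Then $\Gamma$ has a $Q$-polynomial ordering, called standard, for which $\theta_i^*=\xi^*[d-i]_q+\zeta^*$ for some scalars $\xi^*\neq 0$, $\zeta^*$. The product is the Cartesian product of graphs. The Shrikhande graph is the Cayley graph of $\mathbb{Z}_4\times\mathbb{Z}_4$ with connection set $\{\pm(1,0),\pm(0,1),\pm(1,1)\}$ ($16$ vertices). $\mathrm{Doob}(d_1,d_2)$ is distance-regular with classical parameters $(d,1,0,3)$, where $d=2d_1+d_2$ is its diameter. *)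

theory Defs
  imports
    Complex_Main
    "HOL-Library.FuncSet"
    "HOL-Library.Indicator_Function"
    "HOL-Library.Numeral_Type"
    "HOL-Library.Product_Plus"
    "Graph_Theory.Graph_Theory"
begin

section \<open>Distance-regular graphs\<close>

text \<open>
  A finite simple undirected graph is a \<^locale>\<open>pair_graph\<close>: an edge is represented by the two
  opposite arcs joining its ends.
\<close>

definition graph_dist :: "'a pair_pre_digraph \<Rightarrow> 'a \<Rightarrow> 'a \<Rightarrow> nat" where
  "graph_dist G x y = (LEAST n. \<exists>p. pre_digraph.awalk (with_proj G) x p y \<and> length p = n)"

definition graph_diam :: "'a pair_pre_digraph \<Rightarrow> nat" where
  "graph_diam G = Max {graph_dist G x y | x y. x \<in> pverts G \<and> y \<in> pverts G}"

definition has_intersection_numbers ::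
    "'a pair_pre_digraph \<Rightarrow> (nat \<Rightarrow> nat) \<Rightarrow> (nat \<Rightarrow> nat) \<Rightarrow> bool" where
  "has_intersection_numbers G b c \<longleftrightarrow>
     pair_graph G \<and> Digraph_Component.connected (with_proj G) \<and>
     (\<forall>x\<in>pverts G. \<forall>y\<in>pverts G. \<forall>i. graph_dist G x y = i \<longrightarrow>
        card {z. (y, z) \<in> parcs G \<and> graph_dist G x z = i + 1} = b i \<and>
        card {z. (y, z) \<in> parcs G \<and> graph_dist G x z + 1 = i} = c i)"

definition distance_regular :: "'a pair_pre_digraph \<Rightarrow> bool" where
  "distance_regular G \<longleftrightarrow> (\<exists>b c. has_intersection_numbers G b c)"

definition gauss_int :: "nat \<Rightarrow> real \<Rightarrow> real" where
  "gauss_int i q = (\<Sum>j<i. q ^ j)"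

definition has_classical_parameters ::
    "'a pair_pre_digraph \<Rightarrow> nat \<Rightarrow> real \<Rightarrow> real \<Rightarrow> real \<Rightarrow> bool" where
  "has_classical_parameters G d q \<alpha> \<beta> \<longleftrightarrow>
     graph_diam G = d \<and>
     (\<exists>b c. has_intersection_numbers G b c \<and>
        (\<forall>i\<le>d. real (b i) = (gauss_int d q - gauss_int i q) * (\<beta> - \<alpha> * gauss_int i q) \<and>
                real (c i) = gauss_int i q * (1 + \<alpha> * gauss_int (i - 1) q)))"


section \<open>The Bose--Mesner algebra and Q-polynomial orderings\<close>

text \<open>
  A matrix with rows and columns indexed by the vertex set \<open>X\<close> is a function of two arguments that
  vanishes outside \<open>X \<times> X\<close>.  Every matrix below has this form, so that equality of functions is
  equality of matrices.
\<close>

type_synonym 'a cmat = "'a \<Rightarrow> 'a \<Rightarrow> complex"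

definition mat_prod :: "'a set \<Rightarrow> 'a cmat \<Rightarrow> 'a cmat \<Rightarrow> 'a cmat" where
  "mat_prod X M N = (\<lambda>x y. \<Sum>z\<in>X. M x z * N z y)"

definition all_ones :: "'a set \<Rightarrow> 'a cmat" where
  "all_ones X = (\<lambda>x y. of_bool (x \<in> X \<and> y \<in> X))"

definition dist_mat :: "'a pair_pre_digraph \<Rightarrow> nat \<Rightarrow> 'a cmat" where
  "dist_mat G i = (\<lambda>x y. of_bool (x \<in> pverts G \<and> y \<in> pverts G \<and> graph_dist G x y = i))"

definition bose_mesner :: "'a pair_pre_digraph \<Rightarrow> 'a cmat set" where
  "bose_mesner G = {M. \<exists>c. M = (\<lambda>x y. \<Sum>i\<le>graph_diam G. c i * dist_mat G i x y)}"

definition bm_idempotent :: "'a pair_pre_digraph \<Rightarrow> 'a cmat \<Rightarrow> bool" where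
  "bm_idempotent G M \<longleftrightarrow> M \<in> bose_mesner G \<and> mat_prod (pverts G) M M = M"

definition bm_primitive_idempotent :: "'a pair_pre_digraph \<Rightarrow> 'a cmat \<Rightarrow> bool" where
  "bm_primitive_idempotent G M \<longleftrightarrow>
     bm_idempotent G M \<and> M \<noteq> (\<lambda>x y. 0) \<and>
     \<not> (\<exists>P Q. bm_idempotent G P \<and> bm_idempotent G Q \<and>
            P \<noteq> (\<lambda>x y. 0) \<and> Q \<noteq> (\<lambda>x y. 0) \<and>
            mat_prod (pverts G) P Q = (\<lambda>x y. 0) \<and> mat_prod (pverts G) Q P = (\<lambda>x y. 0) \<and>
            M = (\<lambda>x y. P x y + Q x y))"

definition idempotent_ordering :: "'a pair_pre_digraph \<Rightarrow> (nat \<Rightarrow> 'a cmat) \<Rightarrow> bool" where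
  "idempotent_ordering G E \<longleftrightarrow>
     bij_betw E {0..graph_diam G} {M. bm_primitive_idempotent G M} \<and>
     E 0 = (\<lambda>x y. all_ones (pverts G) x y / of_nat (card (pverts G)))"

text \<open>
  The conditionals implement the conventions \<open>E\<^bsub>-1\<^esub> = E\<^bsub>d+1\<^esub> = 0\<close>; the values of \<open>E i\<close> for
  \<open>i > d\<close> are irrelevant.
\<close>

definition Q_polynomial_ordering :: "'a pair_pre_digraph \<Rightarrow> (nat \<Rightarrow> 'a cmat) \<Rightarrow> bool" where
  "Q_polynomial_ordering G E \<longleftrightarrow>
     distance_regular G \<and> idempotent_ordering G E \<and>
     (let d = graph_diam G in
      \<exists>as bs cs :: nat \<Rightarrow> complex.
        bs d = 0 \<and> cs 0 = 0 \<and> (\<forall>i\<in>{1..d}. bs (i - 1) * cs i \<noteq> 0) \<and>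
        (\<forall>i\<le>d. (\<lambda>x y. E 1 x y * E i x y) =
          (\<lambda>x y. ((if i = 0 then 0 else bs (i - 1) * E (i - 1) x y)
                  + as i * E i x y
                  + (if i = d then 0 else cs (i + 1) * E (i + 1) x y))
                / of_nat (card (pverts G)))))"

text \<open>
  The standard ordering of a graph with classical parameters \<open>(d, q, \<alpha>, \<beta>)\<close>; \<open>\<theta> i\<close> is the
  dual eigenvalue, that is, the coefficient of the distance-\<open>i\<close> matrix in \<open>|X| E\<^sub>1\<close>.
\<close>

definition standard_ordering ::
    "'a pair_pre_digraph \<Rightarrow> nat \<Rightarrow> real \<Rightarrow> real \<Rightarrow> real \<Rightarrow> (nat \<Rightarrow> 'a cmat) \<Rightarrow> bool" where
  "standard_ordering G d q \<alpha> \<beta> E \<longleftrightarrow>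
     has_classical_parameters G d q \<alpha> \<beta> \<and> Q_polynomial_ordering G E \<and>
     (\<exists>(\<theta> :: nat \<Rightarrow> complex) \<xi> \<zeta>.
        (\<lambda>x y. of_nat (card (pverts G)) * E 1 x y) = (\<lambda>x y. \<Sum>i\<le>d. \<theta> i * dist_mat G i x y) \<and>
        \<xi> \<noteq> 0 \<and> (\<forall>i\<le>d. \<theta> i = \<xi> * of_real (gauss_int (d - i) q) + \<zeta>))"


section \<open>Width, dual width and descendents\<close>

definition char_form :: "'a set \<Rightarrow> 'a cmat \<Rightarrow> 'a set \<Rightarrow> complex" where
  "char_form X M Y = (\<Sum>x\<in>X. \<Sum>y\<in>X. indicator Y x * M x y * indicator Y y)"

definition width :: "'a pair_pre_digraph \<Rightarrow> 'a set \<Rightarrow> nat" where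
  "width G Y = Max {i. i \<le> graph_diam G \<and> char_form (pverts G) (dist_mat G i) Y \<noteq> 0}"

definition dual_width :: "'a pair_pre_digraph \<Rightarrow> (nat \<Rightarrow> 'a cmat) \<Rightarrow> 'a set \<Rightarrow> nat" where
  "dual_width G E Y = Max {i. i \<le> graph_diam G \<and> char_form (pverts G) (E i) Y \<noteq> 0}"

definition descendent :: "'a pair_pre_digraph \<Rightarrow> (nat \<Rightarrow> 'a cmat) \<Rightarrow> 'a set \<Rightarrow> bool" where
  "descendent G E Y \<longleftrightarrow>
     Y \<noteq> {} \<and> Y \<subseteq> pverts G \<and> width G Y + dual_width G E Y = graph_diam G"


section \<open>Doob graphs\<close>

definition cayley_graph :: "'a::group_add set \<Rightarrow> 'a pair_pre_digraph" where
  "cayley_graph S = \<lparr>pverts = UNIV, parcs = {(x, y). y - x \<in> S}\<rparr>"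

definition complete_graph :: "'a set \<Rightarrow> 'a pair_pre_digraph" where
  "complete_graph V = \<lparr>pverts = V, parcs = {(x, y). x \<in> V \<and> y \<in> V \<and> x \<noteq> y}\<rparr>"

definition image_graph :: "('a \<Rightarrow> 'b) \<Rightarrow> 'a pair_pre_digraph \<Rightarrow> 'b pair_pre_digraph" where
  "image_graph f G = \<lparr>pverts = f ` pverts G, parcs = map_prod f f ` parcs G\<rparr>"

definition cartesian_product ::
    "'i set \<Rightarrow> ('i \<Rightarrow> 'a pair_pre_digraph) \<Rightarrow> ('i \<Rightarrow> 'a) pair_pre_digraph" where
  "cartesian_product I G =
     \<lparr>pverts = (\<Pi>\<^sub>E i\<in>I. pverts (G i)),
      parcs = {(x, y). x \<in> (\<Pi>\<^sub>E i\<in>I. pverts (G i)) \<and> y \<in> (\<Pi>\<^sub>E i\<in>I. pverts (G i)) \<and>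
                 (\<exists>i\<in>I. (x i, y i) \<in> parcs (G i) \<and> (\<forall>j\<in>I - {i}. x j = y j))}\<rparr>"

text \<open>
  The numeral type \<^typ>\<open>4\<close> is the ring of integers modulo 4.
\<close>

definition shrikhande :: "(4 \<times> 4) pair_pre_digraph" where
  "shrikhande = cayley_graph {(1, 0), - (1, 0), (0, 1), - (0, 1), (1, 1), - (1, 1)}"

definition K4 :: "4 pair_pre_digraph" where
  "K4 = complete_graph UNIV"

text \<open>
  The factors must share one vertex type, so the two kinds of factors are copied into a disjoint sum.
\<close>

definition doob_factor :: "nat \<Rightarrow> nat \<Rightarrow> ((4 \<times> 4) + 4) pair_pre_digraph" where
  "doob_factor d1 i = (if i \<le> d1 then image_graph Inl shrikhande else image_graph Inr K4)"

definition doob :: "nat \<Rightarrow> nat \<Rightarrow> (nat \<Rightarrow> (4 \<times> 4) + 4) pair_pre_digraph" where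
  "doob d1 d2 = cartesian_product {1..d1 + d2} (doob_factor d1)"

end

theory Submission
  imports Defs "HOL-Computational_Algebra.Polynomial"
begin

text \<open>
  In a Q-polynomial ordering with \<open>\<theta>\<^sup>*\<^sub>i\<close> affine in \<open>i\<close>, the entries of \<open>E\<^sub>j\<close> are given by a polynomial
  \<open>P\<^sub>j\<close> of degree \<open>j\<close> in the distance.  If \<open>Y\<close> has width \<open>w\<close> and dual width \<open>d - w\<close>, then for every
  vertex \<open>x\<close> the number of elements of \<open>Y\<close> at distance \<open>l\<close> from \<open>x\<close> is the valency \<open>k\<^sub>l\<close> times a
  polynomial in \<open>l\<close> of degree at most \<open>d - w\<close>.  For \<open>x \<in> Y\<close> it vanishes at \<open>w + 1, \<dots>, d\<close>, which
  determines it.  Counting edges of \<open>Y\<close> between consecutive spheres about \<open>x\<close> then shows that \<open>Y\<close> is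
  strongly closed: it contains each neighbour \<open>z\<close> of \<open>y \<in> Y\<close> that is not farther from \<open>x\<close> than \<open>y\<close>.
  Since distances add up in a Cartesian product, a strongly closed subset is the product of its
  projections, and these are strongly closed subsets of \<open>K\<^sub>4\<close> and the Shrikhande graph.
\<close>


section \<open>Distances in graphs\<close>

context pair_graph
begin

text \<open>Relational powers can be split at either end, which makes them handier than arc lists.
  For \<open>n = 0\<close> the empty walk must start at a vertex, whence the assumption on
  \<open>x\<close>.\<close>

lemma ex_awalk_length_iff_relpow:
  assumes "x \<in> pverts G"
  shows "(\<exists>p. awalk x p y \<and> length p = n) \<longleftrightarrow> (x, y) \<in> parcs G ^^ n"
  using assms
proof (induction n arbitrary: x)
  case 0
  then show ?case by (auto simp: awalk_def)
next
  case (Suc n)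
  have "(\<exists>p. awalk x p y \<and> length p = Suc n) \<longleftrightarrow>
      (\<exists>v. (x, v) \<in> parcs G \<and> (\<exists>p. awalk v p y \<and> length p = n))"
  proof
    assume "\<exists>p. awalk x p y \<and> length p = Suc n"
    then obtain e p where "awalk x (e # p) y" "length p = n" by (metis length_Suc_conv)
    then show "\<exists>v. (x, v) \<in> parcs G \<and> (\<exists>p. awalk v p y \<and> length p = n)"
      by (cases e) (auto simp: awalk_def dest: in_arcsD2)
  next
    assume "\<exists>v. (x, v) \<in> parcs G \<and> (\<exists>p. awalk v p y \<and> length p = n)"
    then obtain v p where "(x, v) \<in> parcs G" "awalk v p y" "length p = n" by blast
    then have "awalk x ((x, v) # p) y \<and> length ((x, v) # p) = Suc n"
      using Suc.prems by (simp add: awalk_def)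
    then show "\<exists>p. awalk x p y \<and> length p = Suc n" by blast
  qed
  also have "\<dots> \<longleftrightarrow> (\<exists>v. (x, v) \<in> parcs G \<and> (v, y) \<in> parcs G ^^ n)"
    using Suc.IH in_arcsD2 by blast
  also have "\<dots> \<longleftrightarrow> (x, y) \<in> parcs G ^^ Suc n"
    by (meson relpow_Suc_D2 relpow_Suc_I2)
  finally show ?case .
qed

lemma graph_dist_eq_Least_relpow:
  "x \<in> pverts G \<Longrightarrow> graph_dist G x y = (LEAST n. (x, y) \<in> parcs G ^^ n)"
  unfolding graph_dist_def using ex_awalk_length_iff_relpow by simp

lemma graph_dist_le: "x \<in> pverts G \<Longrightarrow> (x, y) \<in> parcs G ^^ n \<Longrightarrow> graph_dist G x y \<le> n"
  by (simp add: graph_dist_eq_Least_relpow Least_le)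

lemma graph_dist_self: "x \<in> pverts G \<Longrightarrow> graph_dist G x x = 0"
  using graph_dist_le[of x x 0] by simp

text \<open>Following \<open>descend\<close> from \<open>y\<close> gives a walk of length
  \<open>\<delta> y\<close>, and \<open>step\<close> shows that no walk is shorter. This criterion
  later computes distances in Cartesian products.\<close>

lemma graph_dist_eqI:
  fixes \<delta> :: "'a \<Rightarrow> nat"
  assumes x: "x \<in> pverts G" and "\<delta> x = 0"
    and step: "\<And>y z. (y, z) \<in> parcs G \<Longrightarrow> \<delta> z \<le> Suc (\<delta> y)"
    and descend: "\<And>y. y \<in> pverts G \<Longrightarrow> y \<noteq> x \<Longrightarrow> \<exists>z. (z, y) \<in> parcs G \<and> \<delta> y = Suc (\<delta> z)"
    and y: "y \<in> pverts G"
  shows "graph_dist G x y = \<delta> y"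
proof -
  have "(x, y) \<in> parcs G ^^ \<delta> y" using y
  proof (induction "\<delta> y" arbitrary: y)
    case 0
    then show ?case using descend by fastforce
  next
    case (Suc n)
    then have "y \<noteq> x" using \<open>\<delta> x = 0\<close> by auto
    then obtain z where "(z, y) \<in> parcs G" "\<delta> y = Suc (\<delta> z)" using descend Suc.prems by blast
    then show ?case using Suc.hyps by (metis in_arcsD1 nat.inject relpow_Suc_I)
  qed
  moreover have "\<delta> y \<le> n" if "(x, y) \<in> parcs G ^^ n" for n
    using that
  proof (induction n arbitrary: y)
    case 0
    then show ?case using \<open>\<delta> x = 0\<close> by simp
  next
    case (Suc n)
    then obtain z where "(x, z) \<in> parcs G ^^ n" "(z, y) \<in> parcs G" by auto
    then show ?case using Suc.IH[of z] step[of z y] by simp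
  qed
  ultimately show ?thesis
    using x by (metis (no_types, lifting) Least_equality graph_dist_eq_Least_relpow)
qed

lemma relpow_parcs_sym: "(x, y) \<in> parcs G ^^ n \<Longrightarrow> (y, x) \<in> parcs G ^^ n"
proof (induction n arbitrary: y)
  case (Suc n)
  then obtain z where "(x, z) \<in> parcs G ^^ n" "(z, y) \<in> parcs G" by auto
  then show ?case using Suc.IH arcs_symmetric by (meson relpow_Suc_I2)
qed simp

end

section \<open>The metric of a connected graph\<close>

locale connected_pair_graph = pair_graph +
  assumes conn: "Digraph_Component.connected (with_proj G)"
begin

abbreviation "X \<equiv> pverts G"
abbreviation vdist (\<open>\<partial>\<close>) where "\<partial> \<equiv> graph_dist G"

lemma finite_X [simp]: "finite X"
  by (rule pair_finite_verts)

lemma X_nonempty: "X \<noteq> {}"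
  using conn unfolding Digraph_Component.connected_def strongly_connected_def
  by (simp add: mk_symmetric_def)

text \<open>Connectedness refers to the symmetric closure, which has the same reachability here
  because arcs are symmetric; so the minimum defining the distance is attained.\<close>

lemma relpow_graph_dist:
  assumes "x \<in> X" "y \<in> X"
  shows "(x, y) \<in> parcs G ^^ \<partial> x y"
proof -
  have "reachable (with_proj (mk_symmetric (with_proj G))) x y"
    using conn assms unfolding Digraph_Component.connected_def strongly_connected_def
    by (simp add: mk_symmetric_def)
  then have "reachable (with_proj G) x y"
    by (simp only: reachable_mk_symmetric_eq[OF sym_arcs])
  then obtain p where "awalk x p y" by (auto simp: reachable_awalk)
  then have "(x, y) \<in> parcs G ^^ length p"
    using ex_awalk_length_iff_relpow[OF assms(1)] by blast
  then show ?thesis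
    using assms(1) by (metis LeastI graph_dist_eq_Least_relpow)
qed

lemma graph_dist_sym: "x \<in> X \<Longrightarrow> y \<in> X \<Longrightarrow> \<partial> x y = \<partial> y x"
  by (meson antisym graph_dist_le relpow_graph_dist relpow_parcs_sym)

lemma graph_dist_eq_0_iff: "x \<in> X \<Longrightarrow> y \<in> X \<Longrightarrow> \<partial> x y = 0 \<longleftrightarrow> x = y"
  using relpow_graph_dist[of x y] by (auto simp: graph_dist_self)

lemma graph_dist_step: "x \<in> X \<Longrightarrow> (y, z) \<in> parcs G \<Longrightarrow> \<partial> x z \<le> Suc (\<partial> x y)"
  by (meson graph_dist_le in_arcsD1 relpow_Suc_I relpow_graph_dist)

lemma graph_dist_step': "x \<in> X \<Longrightarrow> (y, z) \<in> parcs G \<Longrightarrow> \<partial> x y \<le> Suc (\<partial> x z)"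
  using graph_dist_step arcs_symmetric by simp

lemma graph_dist_eq_1_iff:
  assumes "x \<in> X" "y \<in> X"
  shows "\<partial> x y = 1 \<longleftrightarrow> (x, y) \<in> parcs G"
proof
  assume "\<partial> x y = 1"
  then show "(x, y) \<in> parcs G" using relpow_graph_dist[OF assms] by simp
next
  assume xy: "(x, y) \<in> parcs G"
  then have "x \<noteq> y" using pair_no_loops by fastforce
  then show "\<partial> x y = 1"
    using graph_dist_eq_0_iff[OF assms] graph_dist_step[OF assms(1) xy] graph_dist_self[OF assms(1)]
    by simp
qed

lemma ex_predecessor:
  assumes "x \<in> X" "y \<in> X" "\<partial> x y = Suc i"
  shows "\<exists>z. (y, z) \<in> parcs G \<and> \<partial> x z = i"
proof -
  obtain z where z: "(x, z) \<in> parcs G ^^ i" "(z, y) \<in> parcs G"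
    using relpow_graph_dist[OF assms(1,2)] assms(3) by auto
  then have "\<partial> x z \<le> i" using assms(1) graph_dist_le by blast
  moreover have "Suc i \<le> Suc (\<partial> x z)" using graph_dist_step[OF assms(1) z(2)] assms(3) by simp
  ultimately show ?thesis using z(2) arcs_symmetric by auto
qed

lemma graph_dist_le_diam:
  assumes "x \<in> X" "y \<in> X"
  shows "\<partial> x y \<le> graph_diam G"
proof -
  have "{\<partial> x y | x y. x \<in> X \<and> y \<in> X} = (\<lambda>(x, y). \<partial> x y) ` (X \<times> X)" by auto
  then have "finite {\<partial> x y | x y. x \<in> X \<and> y \<in> X}" by simp
  then show ?thesis unfolding graph_diam_def using assms by (auto intro!: Max_ge)
qed

end


section \<open>The Bose--Mesner algebra of a distance-regular graph\<close>

locale drg = connected_pair_graph +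
  fixes b c :: "nat \<Rightarrow> nat"
  assumes inter: "has_intersection_numbers G b c"
begin

lemma card_up:
  "x \<in> X \<Longrightarrow> y \<in> X \<Longrightarrow> card {z. (y, z) \<in> parcs G \<and> \<partial> x z = Suc (\<partial> x y)} = b (\<partial> x y)"
  using inter unfolding has_intersection_numbers_def by auto

lemma card_down:
  "x \<in> X \<Longrightarrow> y \<in> X \<Longrightarrow> card {z. (y, z) \<in> parcs G \<and> Suc (\<partial> x z) = \<partial> x y} = c (\<partial> x y)"
  using inter unfolding has_intersection_numbers_def by auto

lemma finite_nbrs [simp]: "finite {z. (x, z) \<in> parcs G}"
  by (rule finite_subset[OF _ finite_X]) (auto dest: in_arcsD2)

lemma finite_nbrs' [simp]: "finite {z. (x, z) \<in> parcs G \<and> P z}"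
  by (rule finite_subset[OF _ finite_nbrs[of x]]) auto

lemma degree: "x \<in> X \<Longrightarrow> card {z. (x, z) \<in> parcs G} = b 0"
proof -
  assume x: "x \<in> X"
  have "{z. (x, z) \<in> parcs G} = {z. (x, z) \<in> parcs G \<and> \<partial> x z = Suc (\<partial> x x)}"
    using x graph_dist_eq_1_iff in_arcsD2 graph_dist_self by auto
  then show ?thesis using card_up[OF x x] x graph_dist_self by simp
qed

lemma c_nonzero: "x \<in> X \<Longrightarrow> y \<in> X \<Longrightarrow> \<partial> x y = Suc i \<Longrightarrow> c (Suc i) \<noteq> 0"
proof -
  assume xy: "x \<in> X" "y \<in> X" "\<partial> x y = Suc i"
  then have "{z. (y, z) \<in> parcs G \<and> Suc (\<partial> x z) = \<partial> x y} \<noteq> {}" using ex_predecessor by auto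
  then show ?thesis using card_down[OF xy(1,2)] xy(3) card_eq_0_iff finite_nbrs' by metis
qed

lemma c_0: "c 0 = 0"
  using X_nonempty card_down graph_dist_self by (metis (mono_tags, lifting) Collect_empty_eq card.empty ex_in_conv nat.distinct(1))

section \<open>Closure of the algebra under multiplication\<close>

abbreviation mprod (infixl \<open>\<odot>\<close> 70) where "M \<odot> N \<equiv> mat_prod X M N"

text \<open>Coordinates in the Bose--Mesner algebra: \<open>f i\<close> is the coefficient of A_i.
  Values of \<open>f\<close> beyond the diameter do not affect the matrix.\<close>

definition bm :: "(nat \<Rightarrow> complex) \<Rightarrow> 'a cmat" where
  "bm f = (\<lambda>x y. if x \<in> X \<and> y \<in> X then f (\<partial> x y) else 0)"

lemma bm_cong: "(\<And>i. i \<le> graph_diam G \<Longrightarrow> f i = g i) \<Longrightarrow> bm f = bm g"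
  unfolding bm_def using graph_dist_le_diam by fastforce

lemma bm_sym: "bm f x y = bm f y x"
  by (simp add: bm_def graph_dist_sym)

lemma dist_mat_eq_bm: "dist_mat G i = bm (\<lambda>j. of_bool (j = i))"
  by (auto simp: dist_mat_def bm_def fun_eq_iff)

lemma sum_dist_mat: "(\<lambda>x y. \<Sum>i\<le>graph_diam G. f i * dist_mat G i x y) = bm f"
  unfolding fun_eq_iff
proof (intro allI)
  fix x y
  show "(\<Sum>i\<le>graph_diam G. f i * dist_mat G i x y) = bm f x y"
  proof (cases "x \<in> X \<and> y \<in> X")
    case True
    then have "(\<Sum>i\<le>graph_diam G. f i * dist_mat G i x y)
        = (\<Sum>i\<le>graph_diam G. if i = \<partial> x y then f i else 0)"
      by (intro sum.cong) (auto simp: dist_mat_def)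
    also have "\<dots> = f (\<partial> x y)" using True graph_dist_le_diam by simp
    finally show ?thesis using True by (simp add: bm_def)
  qed (auto simp: dist_mat_def bm_def)
qed

lemma bose_mesner_eq: "bose_mesner G = range bm"
  unfolding bose_mesner_def sum_dist_mat by auto

text \<open>A neighbour of \<open>y\<close> lies at distance i - 1, i or i + 1 from
  \<open>x\<close>, and b_0 - b_i - c_i of them are at distance i. For \<open>i = 0\<close> the
  truncated \<open>i - 1\<close> is harmless since \<open>c 0 = 0\<close>.\<close>

lemma sum_nbrs:
  fixes f :: "nat \<Rightarrow> complex"
  assumes "x \<in> X" "y \<in> X" and i: "i = \<partial> x y"
  shows "(\<Sum>z | (y, z) \<in> parcs G. f (\<partial> x z)) =
    of_nat (b i) * f (Suc i) + of_nat (c i) * f (i - 1) + (of_nat (b 0) - of_nat (b i) - of_nat (c i)) * f i"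
proof -
  let ?N = "{z. (y, z) \<in> parcs G}"
  have "f (\<partial> x z) = f i + (f (Suc i) - f i) * of_bool (\<partial> x z = Suc i)
      + (f (i - 1) - f i) * of_bool (Suc (\<partial> x z) = i)" if "z \<in> ?N" for z
  proof -
    have "(y, z) \<in> parcs G" using that by simp
    then have "\<partial> x z \<le> Suc i" "i \<le> Suc (\<partial> x z)"
      using graph_dist_step[OF assms(1)] graph_dist_step'[OF assms(1)] i by auto
    then have "\<partial> x z = Suc i \<or> \<partial> x z = i \<or> Suc (\<partial> x z) = i" by linarith
    then show ?thesis by auto
  qed
  then have "(\<Sum>z\<in>?N. f (\<partial> x z)) = (\<Sum>z\<in>?N. f i + (f (Suc i) - f i) * of_bool (\<partial> x z = Suc i)
      + (f (i - 1) - f i) * of_bool (Suc (\<partial> x z) = i))"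
    by (rule sum.cong[OF refl])
  also have "\<dots> = of_nat (card ?N) * f i
      + (f (Suc i) - f i) * of_nat (card {z. (y, z) \<in> parcs G \<and> \<partial> x z = Suc i})
      + (f (i - 1) - f i) * of_nat (card {z. (y, z) \<in> parcs G \<and> Suc (\<partial> x z) = i})"
    by (simp add: sum.distrib sum_distrib_left[symmetric] Int_def)
  finally show ?thesis
    using degree[OF assms(2)] card_up[OF assms(1,2)] card_down[OF assms(1,2)] i
    by (simp add: algebra_simps)
qed

lemma mprod_assoc: "(M \<odot> N) \<odot> P = M \<odot> (N \<odot> P)"
  unfolding mat_prod_def fun_eq_iff
  by (auto simp: sum_distrib_left sum_distrib_right mult.assoc intro: sum.swap)

lemma mprod_diff_left: "(\<lambda>x y. M x y - N x y) \<odot> P = (\<lambda>x y. (M \<odot> P) x y - (N \<odot> P) x y)"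
  by (simp add: mat_prod_def algebra_simps sum_subtractf)

lemma mprod_diff_right: "P \<odot> (\<lambda>x y. M x y - N x y) = (\<lambda>x y. (P \<odot> M) x y - (P \<odot> N) x y)"
  by (simp add: mat_prod_def algebra_simps sum_subtractf)

lemma mprod_scale_left: "(\<lambda>x y. k * M x y) \<odot> N = (\<lambda>x y. k * (M \<odot> N) x y)"
  by (simp add: mat_prod_def sum_distrib_left mult.assoc)

lemma mprod_sum_left: "(\<lambda>x y. \<Sum>i\<in>I. M i x y) \<odot> N = (\<lambda>x y. \<Sum>i\<in>I. (M i \<odot> N) x y)"
  unfolding mat_prod_def fun_eq_iff by (auto simp: sum_distrib_right intro: sum.swap)

lemma bm_diff: "(\<lambda>x y. bm f x y - bm g x y) = bm (\<lambda>i. f i - g i)"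
  by (auto simp: bm_def fun_eq_iff)

lemma dist_mat_1_mprod_bm:
  "dist_mat G 1 \<odot> bm f = bm (\<lambda>i. of_nat (b i) * f (Suc i) + of_nat (c i) * f (i - 1)
      + (of_nat (b 0) - of_nat (b i) - of_nat (c i)) * f i)" (is "_ = bm ?g")
  unfolding fun_eq_iff
proof (intro allI)
  fix x y
  show "(dist_mat G 1 \<odot> bm f) x y = bm ?g x y"
  proof (cases "x \<in> X \<and> y \<in> X")
    case True
    then have "(dist_mat G 1 \<odot> bm f) x y = (\<Sum>z\<in>X. if (x, z) \<in> parcs G then f (\<partial> y z) else 0)"
      unfolding mat_prod_def
      by (intro sum.cong) (auto simp: dist_mat_def bm_def graph_dist_eq_1_iff[symmetric] graph_dist_sym)
    also have "\<dots> = (\<Sum>z | (x, z) \<in> parcs G. f (\<partial> y z))"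
      by (intro sum.mono_neutral_cong_right) (auto dest: in_arcsD2)
    also have "\<dots> = ?g (\<partial> y x)" using sum_nbrs True by simp
    also have "\<dots> = bm ?g x y" using True graph_dist_sym[of x y] by (simp add: bm_def)
    finally show ?thesis .
  qed (auto simp: mat_prod_def dist_mat_def bm_def)
qed

text \<open>Induction on \<open>i\<close>: \<open>c\<^bsub>i+1\<^esub> A\<^bsub>i+1\<^esub>\<close> is a
  combination of \<open>A\<^sub>1 A\<^sub>i\<close>, \<open>A\<^sub>i\<close> and \<open>A\<^bsub>i-1\<^esub>\<close>.\<close>

lemma dist_mat_mprod_bm: "\<exists>h. dist_mat G i \<odot> bm f = bm h"
proof (induction i arbitrary: f rule: less_induct)
  case (less i)
  show ?case
  proof (cases i)
    case 0
    have "dist_mat G 0 \<odot> bm f = bm f" unfolding fun_eq_iff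
    proof (intro allI)
      fix x y
      have pos: "0 < \<partial> u v" if "u \<in> X" "v \<in> X" "v \<noteq> u" for u v
        using graph_dist_eq_0_iff that by blast
      have "(dist_mat G 0 \<odot> bm f) x y = (\<Sum>z\<in>X. if z = x then bm f x y else 0)"
        unfolding mat_prod_def
        by (intro sum.cong) (auto simp: dist_mat_def bm_def graph_dist_self pos)
      also have "\<dots> = bm f x y" by (simp add: bm_def)
      finally show "(dist_mat G 0 \<odot> bm f) x y = bm f x y" .
    qed
    then show ?thesis using 0 by blast
  next
    case (Suc j)
    show ?thesis
    proof (cases "\<exists>x\<in>X. \<exists>y\<in>X. \<partial> x y = Suc j")
      \<comment> \<open>If distance j + 1 does not occur, the matrix is zero; otherwise c_{j+1} is
        nonzero and can be inverted.\<close>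
      case False
      then have "dist_mat G i = bm (\<lambda>_. 0)"
        by (auto simp: Suc dist_mat_def bm_def fun_eq_iff)
      then have "dist_mat G i \<odot> bm f = bm (\<lambda>_. 0)"
        by (simp add: mat_prod_def bm_def fun_eq_iff)
      then show ?thesis by blast
    next
      case True
      then have c: "c (Suc j) \<noteq> 0" using c_nonzero by blast
      \<comment> \<open>Coefficients in A_1 A_j = b_{j-1} A_{j-1} + a_j A_j + c_{j+1} A_{j+1}. For
        \<open>j = 0\<close> the truncated \<open>j - 1\<close> would repeat A_0, so
        \<open>b'\<close> is set to 0.\<close>
      define a where "a = (of_nat (b 0) - of_nat (b j) - of_nat (c j) :: complex)"
      define b' where "b' = (if j = 0 then 0 else of_nat (b (j - 1)) :: complex)"
      have A: "dist_mat G i = (\<lambda>x y. inverse (of_nat (c (Suc j))) *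
          ((dist_mat G 1 \<odot> dist_mat G j) x y - (b' * dist_mat G (j - 1) x y + a * dist_mat G j x y)))"
      proof -
        have "dist_mat G 1 \<odot> dist_mat G j = bm (\<lambda>i. of_nat (b i) * of_bool (Suc i = j)
            + of_nat (c i) * of_bool (i - 1 = j) + (of_nat (b 0) - of_nat (b i) - of_nat (c i)) * of_bool (i = j))"
          unfolding dist_mat_eq_bm[of j] dist_mat_1_mprod_bm ..
        also have "\<dots> = bm (\<lambda>i. of_nat (c (Suc j)) * of_bool (i = Suc j)
            + (b' * of_bool (i = j - 1) + a * of_bool (i = j)))"
          using c_0 by (intro arg_cong[of _ _ bm]) (auto simp: fun_eq_iff a_def b'_def split: nat_diff_split)
        finally show ?thesis using c
          by (auto simp: Suc fun_eq_iff bm_def dist_mat_eq_bm)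
      qed
      have "j - 1 < i" "j < i" using Suc by auto
      then obtain h2 h3 where h23: "dist_mat G (j - 1) \<odot> bm f = bm h2" "dist_mat G j \<odot> bm f = bm h3"
        using less by blast
      obtain h1 where h1: "(dist_mat G 1 \<odot> dist_mat G j) \<odot> bm f = bm h1"
        unfolding mprod_assoc h23 dist_mat_1_mprod_bm by blast
      note h = h1 h23
      have "dist_mat G i \<odot> bm f = (\<lambda>x y. inverse (of_nat (c (Suc j))) *
          (((dist_mat G 1 \<odot> dist_mat G j) \<odot> bm f) x y
            - (b' * (dist_mat G (j - 1) \<odot> bm f) x y + a * (dist_mat G j \<odot> bm f) x y)))"
        unfolding A by (simp add: mat_prod_def fun_eq_iff sum_distrib_left sum.distrib sum_subtractf algebra_simps)
      also have "\<dots> = bm (\<lambda>i. inverse (of_nat (c (Suc j))) * (h1 i - (b' * h2 i + a * h3 i)))"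
        unfolding h by (auto simp: bm_def fun_eq_iff)
      finally show ?thesis by blast
    qed
  qed
qed

lemma bm_mprod_bm: "\<exists>h. bm f \<odot> bm g = bm h"
proof -
  have "\<exists>h. \<forall>i. dist_mat G i \<odot> bm g = bm (h i)"
    using dist_mat_mprod_bm by (intro choice) blast
  then obtain h where h: "\<And>i. dist_mat G i \<odot> bm g = bm (h i)" by blast
  have "bm f \<odot> bm g = (\<lambda>x y. \<Sum>i\<le>graph_diam G. f i * (dist_mat G i \<odot> bm g) x y)"
    unfolding sum_dist_mat[of f, symmetric] mprod_sum_left mprod_scale_left ..
  also have "\<dots> = bm (\<lambda>j. \<Sum>i\<le>graph_diam G. f i * h i j)"
    unfolding h by (auto simp: bm_def fun_eq_iff)
  finally show ?thesis by blast
qed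

lemma mprod_closed: "M \<in> bose_mesner G \<Longrightarrow> N \<in> bose_mesner G \<Longrightarrow> M \<odot> N \<in> bose_mesner G"
  unfolding bose_mesner_eq using bm_mprod_bm by blast

text \<open>All elements of the algebra are symmetric, the product included, so transposing
  \<open>M \<odot> N\<close> yields \<open>N \<odot> M\<close>.\<close>

lemma mprod_commute:
  assumes "M \<in> bose_mesner G" "N \<in> bose_mesner G"
  shows "M \<odot> N = N \<odot> M"
proof -
  have sym: "P x y = P y x" if "P \<in> bose_mesner G" for P x y
    using that bm_sym unfolding bose_mesner_eq by auto
  have "(M \<odot> N) x y = (N \<odot> M) x y" for x y
  proof -
    have "(M \<odot> N) x y = (M \<odot> N) y x" using sym mprod_closed assms by blast
    also have "\<dots> = (N \<odot> M) x y"
      unfolding mat_prod_def using sym[OF assms(1)] sym[OF assms(2)] by (simp add: mult.commute)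
    finally show ?thesis .
  qed
  then show ?thesis by blast
qed

section \<open>Primitive idempotents\<close>

lemma diff_closed: "M \<in> bose_mesner G \<Longrightarrow> N \<in> bose_mesner G \<Longrightarrow> (\<lambda>x y. M x y - N x y) \<in> bose_mesner G"
  unfolding bose_mesner_eq using bm_diff by auto

text \<open>Otherwise E = EF + (E - EF) would split E into two nonzero orthogonal
  idempotents.\<close>

lemma primitive_mprod_cases:
  assumes E: "bm_primitive_idempotent G E" and F: "bm_idempotent G F"
  shows "E \<odot> F = (\<lambda>x y. 0) \<or> E \<odot> F = E"
proof (rule ccontr)
  assume neither: "\<not> ?thesis"
  define P where "P = E \<odot> F"
  define Q where "Q = (\<lambda>x y. E x y - P x y)"
  have EB: "E \<in> bose_mesner G" "E \<odot> E = E" and FB: "F \<in> bose_mesner G" "F \<odot> F = F"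
    using E F by (auto simp: bm_primitive_idempotent_def bm_idempotent_def)
  have PB: "P \<in> bose_mesner G" and QB: "Q \<in> bose_mesner G"
    using EB FB mprod_closed diff_closed by (auto simp: P_def Q_def)
  have EP: "E \<odot> P = P" unfolding P_def using EB mprod_assoc by metis
  have PE: "P \<odot> E = P" using EP mprod_commute PB EB by metis
  have PF: "P \<odot> F = P" unfolding P_def using FB mprod_assoc by metis
  have PP: "P \<odot> P = P" using PE PF unfolding P_def by (metis mprod_assoc)
  have "P \<odot> Q = (\<lambda>x y. 0)" "Q \<odot> P = (\<lambda>x y. 0)" "Q \<odot> Q = Q"
    unfolding Q_def mprod_diff_left mprod_diff_right by (simp_all add: EP PE PP EB fun_eq_iff)
  moreover have "P \<noteq> (\<lambda>x y. 0)" using neither P_def by auto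
  moreover have "Q \<noteq> (\<lambda>x y. 0)" using neither unfolding Q_def P_def by (metis eq_iff_diff_eq_0 ext)
  moreover have "E = (\<lambda>x y. P x y + Q x y)" by (simp add: Q_def)
  ultimately show False
    using E PB QB PP unfolding bm_primitive_idempotent_def bm_idempotent_def by blast
qed

text \<open>EF = FE is 0 or E, and likewise 0 or F; if it is nonzero, then E = F.\<close>

lemma primitive_orthogonal:
  assumes E: "bm_primitive_idempotent G E" and F: "bm_primitive_idempotent G F" and "E \<noteq> F"
  shows "E \<odot> F = (\<lambda>x y. 0)"
proof -
  have "bm_idempotent G E" "bm_idempotent G F"
    using E F by (auto simp: bm_primitive_idempotent_def)
  moreover then have "E \<odot> F = F \<odot> E"
    using mprod_commute by (auto simp: bm_idempotent_def)
  ultimately show ?thesis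
    using primitive_mprod_cases E F \<open>E \<noteq> F\<close> by metis
qed

lemma sum_norm_sq_row_eq_0:
  assumes "\<And>x. (\<Sum>z\<in>X. M x z * cnj (M x z)) = 0" "x \<in> X" "y \<in> X"
  shows "M x y = 0"
proof -
  have "complex_of_real (\<Sum>z\<in>X. (cmod (M x z))\<^sup>2) = 0"
    using assms(1)[of x] by (simp only: complex_norm_square[symmetric] of_real_sum)
  then have "(\<Sum>z\<in>X. (cmod (M x z))\<^sup>2) = 0" by (simp only: of_real_eq_0_iff)
  then show ?thesis using assms(3) by (simp add: sum_nonneg_eq_0_iff)
qed

text \<open>\<open>E\<close> and its complex conjugate commute and \<open>E E\<^sup>* \<noteq> 0\<close>, so primitivity forces \<open>E E\<^sup>* = E\<close>.\<close>

lemma primitive_cnj: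
  assumes E: "bm_primitive_idempotent G E"
  shows "cnj (E x y) = E x y"
proof -
  define F where "F = (\<lambda>x y. cnj (E x y))"
  have EB: "E \<in> bose_mesner G" "E \<odot> E = E" "E \<noteq> (\<lambda>x y. 0)"
    using E by (auto simp: bm_primitive_idempotent_def bm_idempotent_def)
  then obtain f where f: "E = bm f" unfolding bose_mesner_eq by blast
  have cnj_mprod: "(\<lambda>x y. cnj ((M \<odot> N) x y)) = (\<lambda>x y. cnj (M x y)) \<odot> (\<lambda>x y. cnj (N x y))" for M N
    by (simp add: mat_prod_def)
  have "F = bm (\<lambda>i. cnj (f i))" by (auto simp: F_def f bm_def fun_eq_iff)
  then have FB: "F \<in> bose_mesner G" unfolding bose_mesner_eq by blast
  have FF: "F \<odot> F = F" unfolding F_def cnj_mprod[symmetric] EB ..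
  have "E \<odot> F \<noteq> (\<lambda>x y. 0)"
  proof
    assume "E \<odot> F = (\<lambda>x y. 0)"
    moreover have "F z x = cnj (E x z)" for x z by (simp add: F_def f bm_sym[of f z x])
    then have "(E \<odot> F) x x = (\<Sum>z\<in>X. E x z * cnj (E x z))" for x
      by (simp add: mat_prod_def)
    ultimately have "(\<Sum>z\<in>X. E x z * cnj (E x z)) = 0" for x by metis
    then have "E x y = 0" for x y
      using sum_norm_sq_row_eq_0[of E] by (cases "x \<in> X \<and> y \<in> X") (auto simp: f bm_def)
    then show False using EB by blast
  qed
  then have EF: "E \<odot> F = E" using primitive_mprod_cases[OF E] FB FF by (auto simp: bm_idempotent_def)
  have "F = F \<odot> E" using EF cnj_mprod[of E F] unfolding F_def by simp
  then have "F = E" using EF mprod_commute FB EB by metis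
  then show ?thesis unfolding F_def by metis
qed

text \<open>Since the matrix is real, symmetric and idempotent, its diagonal entry
  \<open>f 0\<close> is the squared norm of each row; a zero diagonal would make the matrix
  zero.\<close>

lemma primitive_diag_nonzero:
  assumes E: "bm_primitive_idempotent G (bm f)"
  shows "f 0 \<noteq> 0"
proof
  assume f0: "f 0 = 0"
  have idem: "bm f \<odot> bm f = bm f" and nz: "bm f \<noteq> (\<lambda>x y. 0)"
    using E by (auto simp: bm_primitive_idempotent_def bm_idempotent_def)
  have "(\<Sum>z\<in>X. bm f x z * cnj (bm f x z)) = 0" for x
  proof -
    have "(\<Sum>z\<in>X. bm f x z * cnj (bm f x z)) = (bm f \<odot> bm f) x x"
      unfolding mat_prod_def by (intro sum.cong refl) (metis primitive_cnj[OF E] bm_sym)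
    also have "\<dots> = 0" unfolding idem using f0 by (simp add: bm_def graph_dist_self)
    finally show ?thesis .
  qed
  then have "bm f x y = 0" for x y
    using sum_norm_sq_row_eq_0[of "bm f"] by (cases "x \<in> X \<and> y \<in> X") (auto simp: bm_def)
  then show False using nz by blast
qed

text \<open>\<open>Y\<^sup>T E Y = \<parallel>E Y\<parallel>\<^sup>2\<close> for an idempotent real symmetric \<open>E\<close>.\<close>

lemma char_form_primitive_eq_0:
  assumes E: "bm_primitive_idempotent G E" and Y: "Y \<subseteq> X" "char_form X E Y = 0" and x: "x \<in> X"
  shows "(\<Sum>y\<in>Y. E x y) = 0"
proof -
  have idem: "E \<odot> E = E" and "E \<in> bose_mesner G"
    using E by (auto simp: bm_primitive_idempotent_def bm_idempotent_def)
  then have sym: "E x y = E y x" for x y using bm_sym unfolding bose_mesner_eq by auto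
  have real: "cnj (E x y) = E x y" for x y by (rule primitive_cnj[OF E])
  have finY: "finite Y" using Y finite_X finite_subset by blast
  have EE: "E x y = (\<Sum>z\<in>X. E z x * E z y)" for x y
  proof -
    have "(E \<odot> E) x y = (\<Sum>z\<in>X. E z x * E z y)"
      unfolding mat_prod_def by (intro sum.cong refl arg_cong2[of _ _ _ _ "(*)"] sym)
    then show ?thesis by (simp add: idem)
  qed
  define v where "v = (\<lambda>z. \<Sum>y\<in>Y. E z y)"
  have "char_form X E Y = (\<Sum>x\<in>Y. \<Sum>y\<in>Y. E x y)"
  proof -
    have "char_form X E Y = (\<Sum>x\<in>Y. \<Sum>y\<in>X. indicator Y x * E x y * indicator Y y)"
      unfolding char_form_def using Y by (intro sum.mono_neutral_right) auto
    also have "\<dots> = (\<Sum>x\<in>Y. \<Sum>y\<in>Y. E x y)"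
      using Y by (intro sum.cong[OF refl] sum.mono_neutral_cong_right) auto
    finally show ?thesis .
  qed
  also have "\<dots> = (\<Sum>x\<in>Y. \<Sum>y\<in>Y. \<Sum>z\<in>X. E z x * E z y)"
    by (intro sum.cong refl EE)
  also have "\<dots> = (\<Sum>x\<in>Y. \<Sum>z\<in>X. \<Sum>y\<in>Y. E z x * E z y)"
    by (intro sum.cong refl sum.swap)
  also have "\<dots> = (\<Sum>z\<in>X. \<Sum>x\<in>Y. \<Sum>y\<in>Y. E z x * E z y)"
    by (rule sum.swap)
  also have "\<dots> = (\<Sum>z\<in>X. v z * v z)"
    unfolding v_def sum_product ..
  also have "\<dots> = (\<Sum>z\<in>X. v z * cnj (v z))"
    unfolding v_def by (simp add: real)
  finally have "(\<Sum>z\<in>X. v z * cnj (v z)) = 0" using Y by simp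
  then show ?thesis
    using sum_norm_sq_row_eq_0[of "\<lambda>_. v" x x] x unfolding v_def by blast
qed

end


section \<open>Q-polynomial orderings and outer distributions\<close>

lemma ex_poly_interpolating:
  fixes f :: "nat \<Rightarrow> 'a :: field_char_0"
  shows "\<exists>p. degree p \<le> n \<and> (\<forall>i\<le>n. poly p (of_nat i) = f i)"
proof (induction n)
  case 0
  show ?case by (intro exI[of _ "[:f 0:]"]) simp
next
  case (Suc n)
  then obtain p where p: "degree p \<le> n" "\<And>i. i \<le> n \<Longrightarrow> poly p (of_nat i) = f i" by blast
  define q where "q = (\<Prod>m\<le>n. [:- of_nat m, 1 :: 'a:])"
  have "degree q \<le> (\<Sum>m\<le>n. degree [:- of_nat m, 1 :: 'a:])"
    unfolding q_def using degree_prod_sum_le[of "{..n}" "\<lambda>m. [:- of_nat m, 1 :: 'a:]"] by (simp add: o_def)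
  then have deg: "degree q \<le> Suc n" by simp
  have q0: "poly q (of_nat i) = 0 \<longleftrightarrow> i \<le> n" for i
    by (auto simp: q_def poly_prod)
  \<comment> \<open>\<open>q\<close> vanishes exactly at the old nodes 0, ..., n, so a multiple of
    it adjusts the value at n + 1 and keeps the earlier ones.\<close>
  define r where "r = p + smult ((f (Suc n) - poly p (of_nat (Suc n))) / poly q (of_nat (Suc n))) q"
  have "degree r \<le> Suc n"
    unfolding r_def using p(1) deg degree_smult_le by (intro degree_add_le) (auto intro: order_trans)
  moreover have "poly r (of_nat i) = f i" if "i \<le> Suc n" for i
  proof (cases "i = Suc n")
    case True
    then show ?thesis using q0[of "Suc n"] by (simp add: r_def del: of_nat_Suc)
  next
    case False
    then show ?thesis using that q0[of i] p(2)[of i] by (simp add: r_def del: of_nat_Suc)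
  qed
  ultimately show ?case by blast
qed

text \<open>Cancel the top coefficient with a multiple of the last polynomial, whose degree is
  exactly \<open>n\<close>, and recurse.\<close>

lemma ex_sum_smult_triangular:
  fixes P :: "nat \<Rightarrow> 'a :: field poly"
  assumes "\<And>j. j \<le> n \<Longrightarrow> degree (P j) = j \<and> P j \<noteq> 0" and "degree p \<le> n"
  shows "\<exists>c. p = (\<Sum>j\<le>n. smult (c j) (P j))"
  using assms
proof (induction n arbitrary: p)
  case 0
  then obtain u v where "p = [:u:]" "P 0 = [:v:]" "v \<noteq> 0"
    by (metis degree_eq_zeroE le_zero_eq pCons_0_0)
  then show ?case by (intro exI[of _ "\<lambda>_. u / v"]) simp
next
  case (Suc n)
  define k where "k = coeff p (Suc n) / coeff (P (Suc n)) (Suc n)"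
  have PS: "degree (P (Suc n)) = Suc n" "P (Suc n) \<noteq> 0" using Suc.prems by auto
  then have lead: "coeff (P (Suc n)) (Suc n) \<noteq> 0" using leading_coeff_neq_0 by metis
  have "coeff (p - smult k (P (Suc n))) i = 0" if "i > n" for i
  proof (cases "i = Suc n")
    case True
    then show ?thesis using lead by (simp add: k_def)
  next
    case False
    then show ?thesis using that Suc.prems(2) PS by (simp add: coeff_eq_0)
  qed
  then have "degree (p - smult k (P (Suc n))) \<le> n" by (intro degree_le) auto
  then obtain c where "p - smult k (P (Suc n)) = (\<Sum>j\<le>n. smult (c j) (P j))"
    using Suc.IH Suc.prems(1) by (metis le_SucI)
  moreover have "(\<Sum>j\<le>n. smult ((c(Suc n := k)) j) (P j)) = (\<Sum>j\<le>n. smult (c j) (P j))"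
    by (intro sum.cong) auto
  ultimately have "p = (\<Sum>j\<le>Suc n. smult ((c(Suc n := k)) j) (P j))"
    by (simp add: algebra_simps)
  then show ?case by blast
qed

context drg
begin

section \<open>Idempotents as polynomials in the distance\<close>

abbreviation bm_poly :: "complex poly \<Rightarrow> 'a cmat" where
  "bm_poly p \<equiv> bm (\<lambda>i. poly p (of_nat i))"

text \<open>Entrywise products of matrices \<open>bm_poly p\<close> are products of polynomials. The
  recurrence can be solved for E_j because \<open>cs j\<close> is nonzero, and multiplication by
  \<open>p1\<close> raises the degree by exactly one.\<close>

lemma Q_polynomial_ordering_polys:
  assumes Q: "Q_polynomial_ordering G E" and p1: "E 1 = bm_poly p1" "degree p1 = 1"
  shows "\<exists>P. \<forall>j\<le>graph_diam G. degree (P j) = j \<and> P j \<noteq> 0 \<and> E j = bm_poly (P j)"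
proof -
  define n where "n = card X"
  have n: "n \<noteq> 0" using X_nonempty by (simp add: n_def)
  obtain as bs cs where nz: "\<forall>i\<in>{1..graph_diam G}. bs (i - 1) * cs i \<noteq> 0" and
    rec: "\<forall>i\<le>graph_diam G. (\<lambda>x y. E 1 x y * E i x y) =
          (\<lambda>x y. ((if i = 0 then 0 else bs (i - 1) * E (i - 1) x y)
                  + as i * E i x y
                  + (if i = graph_diam G then 0 else cs (i + 1) * E (i + 1) x y))
                / of_nat (card X))"
    using Q unfolding Q_polynomial_ordering_def Let_def by blast
  have E0: "E 0 = (\<lambda>x y. all_ones X x y / of_nat n)"
    using Q unfolding Q_polynomial_ordering_def idempotent_ordering_def n_def by blast
  have "\<exists>p. degree p = j \<and> p \<noteq> 0 \<and> E j = bm_poly p" if "j \<le> graph_diam G" for j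
    using that
  proof (induction j rule: less_induct)
    case (less j)
    \<comment> \<open>For j >= 2 the recurrence is read at i = j - 1, where 0 < i < D, so neither
      boundary convention applies.\<close>
    consider "j = 0" | "j = 1" | i where "j = Suc i" "i \<noteq> 0" by (cases j; cases "j - 1") auto
    then show ?case
    proof cases
      case 1
      have "E 0 = bm_poly [:1 / of_nat n:]" by (auto simp: E0 all_ones_def bm_def fun_eq_iff)
      then show ?thesis using 1 n by (intro exI[of _ "[:1 / of_nat n:]"]) simp
    next
      case 2
      then show ?thesis using p1 by (intro exI[of _ p1]) auto
    next
      case 3
      then have i: "i \<le> graph_diam G" "i < j" "i - 1 < j" "i \<noteq> graph_diam G" "i - 1 \<le> graph_diam G"
        using less.prems by auto
      obtain p where p: "degree p = i" "p \<noteq> 0" "E i = bm_poly p" using less.IH i by blast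
      obtain q where q: "degree q = i - 1" "q \<noteq> 0" "E (i - 1) = bm_poly q" using less.IH i by blast
      have cs: "cs j \<noteq> 0" using nz[rule_format, of j] 3 less.prems by auto
      define r where "r = smult (1 / cs j)
        (smult (of_nat n) (p1 * p) + - (smult (bs (i - 1)) q + smult (as i) p))"
      have "p1 \<noteq> 0" using p1(2) by auto
      have "degree (smult (of_nat n) (p1 * p)) = j"
        using n p p1 3 \<open>p1 \<noteq> 0\<close> by (simp add: degree_mult_eq)
      moreover have "degree (smult (bs (i - 1)) q + smult (as i) p) < j"
      proof -
        have "degree (smult (bs (i - 1)) q + smult (as i) p) \<le> i"
          using p(1) q(1) by (intro degree_add_le) (auto intro: order_trans[OF degree_smult_le])
        then show ?thesis using i by simp
      qed
      ultimately have "degree (smult (of_nat n) (p1 * p) + - (smult (bs (i - 1)) q + smult (as i) p)) = j"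
        by (simp only: degree_add_eq_left degree_minus)
      then have deg: "degree r = j" unfolding r_def using cs by (simp only: degree_smult_eq) simp
      have "E j x y = bm_poly r x y" for x y
      proof -
        have "E 1 x y * E i x y = (bs (i - 1) * E (i - 1) x y + as i * E i x y + cs j * E j x y) / of_nat n"
          using fun_cong[OF fun_cong[OF rec[rule_format, OF i(1)], of x], of y] 3 i by (simp add: n_def)
        then have "E j x y = 1 / cs j * (of_nat n * (E 1 x y * E i x y) - (bs (i - 1) * E (i - 1) x y + as i * E i x y))"
          using n cs by (simp add: field_simps)
        then show ?thesis unfolding p(3) q(3) p1(1) by (simp add: bm_def r_def)
      qed
      then have "E j = bm_poly r" by blast
      then show ?thesis using deg 3 by (intro exI[of _ r]) auto
    qed
  qed
  then show ?thesis by metis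
qed

text \<open>\<open>A\<^sub>l E\<^sub>j\<close> is a multiple of \<open>E\<^sub>j\<close>, and comparing diagonal entries the multiple is
  \<open>k\<^sub>l P\<^sub>j(l) / P\<^sub>j(0)\<close>, a polynomial in \<open>l\<close> up to the valency \<open>k\<^sub>l\<close>.\<close>

lemma outer_distribution:
  assumes ord: "idempotent_ordering G E"
    and P: "\<And>j. j \<le> graph_diam G \<Longrightarrow> degree (P j) = j \<and> P j \<noteq> 0 \<and> E j = bm_poly (P j)"
    and Y: "Y \<subseteq> X" "\<And>j. s < j \<Longrightarrow> j \<le> graph_diam G \<Longrightarrow> char_form X (E j) Y = 0"
    and s: "s \<le> graph_diam G" and x: "x \<in> X"
  shows "\<exists>p :: complex poly. degree p \<le> s \<and> (\<forall>l\<le>graph_diam G.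
    of_nat (card {y\<in>Y. \<partial> x y = l}) = of_nat (card {z\<in>X. \<partial> x z = l}) * poly p (of_nat l))"
proof -
  let ?D = "graph_diam G"
  have prim: "bm_primitive_idempotent G (E j)" if "j \<le> ?D" for j
    using ord that unfolding idempotent_ordering_def bij_betw_def by auto
  have orth: "E i \<odot> E j = (if i = j then E j else (\<lambda>x y. 0))" if "i \<le> ?D" "j \<le> ?D" for i j
  proof (cases "i = j")
    case True
    then show ?thesis using prim that by (simp add: bm_primitive_idempotent_def bm_idempotent_def)
  next
    case False
    have "inj_on E {0..?D}" using ord unfolding idempotent_ordering_def bij_betw_def by blast
    then have "E i \<noteq> E j" using False that by (auto dest: inj_onD)
    then show ?thesis using False primitive_orthogonal prim that by simp
  qed
  have finY: "finite Y" using Y finite_X finite_subset by blast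
  \<comment> \<open>The entry at \<open>x\<close> of E_j applied to the characteristic vector of
    \<open>Y\<close>; it vanishes for \<open>j > s\<close>.\<close>
  define v where "v j = (\<Sum>y\<in>Y. E j x y)" for j
  have v0: "v j = 0" if "s < j" "j \<le> ?D" for j
    unfolding v_def using char_form_primitive_eq_0[OF prim[OF that(2)] Y(1) Y(2)[OF that] x] .
  have P0: "poly (P j) 0 \<noteq> 0" if "j \<le> ?D" for j
    using primitive_diag_nonzero[of "\<lambda>i. poly (P j) (of_nat i)"] prim P that by simp
  define p where "p = (\<Sum>j\<le>s. smult (v j / poly (P j) 0) (P j))"
  have "degree p \<le> s"
    unfolding p_def using P s by (intro degree_sum_le) (auto intro: order_trans[OF degree_smult_le])
  moreover have "of_nat (card {y\<in>Y. \<partial> x y = l}) = of_nat (card {z\<in>X. \<partial> x z = l}) * poly p (of_nat l)"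
    if l: "l \<le> ?D" for l
  proof -
    define k where "k = (of_nat (card {z\<in>X. \<partial> x z = l}) :: complex)"
    \<comment> \<open>\<open>q\<close> is 1 at l and 0 at the other distances, so A_l is the matrix
      of \<open>q\<close>. Expanding \<open>q\<close> in the P_j exhibits the eigenvalue
      \<open>a j\<close> of A_l on E_j.\<close>
    obtain q :: "complex poly" where q: "degree q \<le> ?D" "\<And>i. i \<le> ?D \<Longrightarrow> poly q (of_nat i) = of_bool (i = l)"
      using ex_poly_interpolating[of ?D "\<lambda>i. of_bool (i = l)"] by blast
    obtain a where a: "q = (\<Sum>j\<le>?D. smult (a j) (P j))"
      using ex_sum_smult_triangular[of ?D P q] P q(1) by blast
    have A: "dist_mat G l = (\<lambda>x y. \<Sum>j\<le>?D. a j * E j x y)"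
    proof -
      have "dist_mat G l = bm_poly q"
        unfolding dist_mat_eq_bm using q(2) by (intro bm_cong) simp
      also have "\<dots> = (\<lambda>x y. \<Sum>j\<le>?D. a j * bm_poly (P j) x y)"
        unfolding a by (auto simp: bm_def fun_eq_iff poly_sum)
      also have "\<dots> = (\<lambda>x y. \<Sum>j\<le>?D. a j * E j x y)"
        using P by (intro ext sum.cong) auto
      finally show ?thesis .
    qed
    have eig: "a j = k * poly (P j) (of_nat l) / poly (P j) 0" if j: "j \<le> ?D" for j
    proof -
      have "dist_mat G l \<odot> E j = (\<lambda>x y. \<Sum>i\<le>?D. a i * (E i \<odot> E j) x y)"
        unfolding A mprod_sum_left mprod_scale_left ..
      also have "\<dots> = (\<lambda>x y. \<Sum>i\<le>?D. if i = j then a j * E j x y else 0)"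
        using orth j by (intro ext sum.cong) auto
      also have "\<dots> = (\<lambda>x y. a j * E j x y)" using j by simp
      finally have "(dist_mat G l \<odot> E j) x x = a j * E j x x" by (rule fun_cong[OF fun_cong])
      moreover have "(dist_mat G l \<odot> E j) x x = k * poly (P j) (of_nat l)"
      proof -
        have "(dist_mat G l \<odot> E j) x x = (\<Sum>z\<in>X. if \<partial> x z = l then poly (P j) (of_nat l) else 0)"
          unfolding mat_prod_def using P[OF j] x graph_dist_sym
          by (intro sum.cong) (auto simp: dist_mat_def bm_def)
        also have "\<dots> = k * poly (P j) (of_nat l)"
          by (simp add: sum.If_cases k_def Int_def)
        finally show ?thesis .
      qed
      moreover have "E j x x = poly (P j) 0" using P[OF j] x by (simp add: bm_def graph_dist_self)
      ultimately show ?thesis using P0[OF j] by (simp add: field_simps)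
    qed
    have "of_nat (card {y\<in>Y. \<partial> x y = l}) = (\<Sum>y\<in>Y. dist_mat G l x y)"
      using Y x finY by (simp add: dist_mat_def Int_def subset_iff conj_commute cong: conj_cong)
    also have "\<dots> = (\<Sum>j\<le>?D. a j * v j)"
      unfolding A v_def sum_distrib_left by (rule sum.swap)
    also have "\<dots> = (\<Sum>j\<le>s. a j * v j)"
      using s v0 by (intro sum.mono_neutral_right) auto
    also have "\<dots> = (\<Sum>j\<le>s. k * (v j / poly (P j) 0 * poly (P j) (of_nat l)))"
      using s eig by (intro sum.cong) auto
    also have "\<dots> = k * poly p (of_nat l)"
      by (simp add: p_def poly_sum sum_distrib_left)
    finally show ?thesis unfolding k_def .
  qed
  ultimately show ?thesis by blast
qed

end


section \<open>Descendents are strongly closed\<close>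

text \<open>Subtracting the right multiple of the monic product, of degree \<open>card R\<close>,
  cancels the top coefficient. What remains still vanishes on \<open>R\<close>, so it has too many
  roots to be nonzero.\<close>

lemma ex_smult_prod_roots:
  fixes p :: "'a :: field poly"
  assumes "finite R" "degree p \<le> card R" "\<And>r. r \<in> R \<Longrightarrow> poly p r = 0"
  shows "\<exists>a. p = smult a (\<Prod>r\<in>R. [:- r, 1:])"
proof -
  define q where "q = (\<Prod>r\<in>R. [:- r, 1:])"
  have deg: "degree q = card R"
    unfolding q_def by (subst degree_prod_sum_eq) (auto simp: o_def)
  have "lead_coeff q = 1" unfolding q_def by (simp add: lead_coeff_prod)
  then have lead: "coeff q (card R) = 1" using deg by simp
  define s where "s = p - smult (coeff p (card R)) q"
  have "s = 0"
  proof (rule ccontr)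
    assume "s \<noteq> 0"
    have "degree s \<le> card R"
      unfolding s_def using assms(2) deg by (intro degree_diff_le) (auto intro: order_trans[OF degree_smult_le])
    moreover have "coeff s (card R) = 0" by (simp add: s_def lead)
    ultimately have "degree s < card R"
      using \<open>s \<noteq> 0\<close> leading_coeff_neq_0 by (metis le_neq_implies_less)
    moreover have "R \<subseteq> {r. poly s r = 0}"
      using assms(1,3) by (auto simp: s_def q_def poly_prod)
    then have "card R \<le> card {r. poly s r = 0}"
      using poly_roots_finite[OF \<open>s \<noteq> 0\<close>] card_mono by blast
    ultimately show False using card_poly_roots_bound[OF \<open>s \<noteq> 0\<close>] by simp
  qed
  then show ?thesis unfolding s_def q_def by (intro exI[of _ "coeff p (card R)"]) simp
qed

context drg
begin

section \<open>Edge counts, width and dual width\<close>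

lemma sum_card_nbrs_swap:
  assumes "finite A" "finite B"
  shows "(\<Sum>y\<in>A. card {z\<in>B. (y, z) \<in> parcs G}) = (\<Sum>z\<in>B. card {y\<in>A. (z, y) \<in> parcs G})"
proof -
  have "(\<Sum>y\<in>A. card {z\<in>B. (y, z) \<in> parcs G}) = (\<Sum>y\<in>A. \<Sum>z\<in>B. of_bool ((y, z) \<in> parcs G))"
    using assms by (simp add: Int_def)
  also have "\<dots> = (\<Sum>z\<in>B. \<Sum>y\<in>A. of_bool ((z, y) \<in> parcs G))"
    using arcs_symmetric by (subst sum.swap) (auto intro!: sum.cong)
  also have "\<dots> = (\<Sum>z\<in>B. card {y\<in>A. (z, y) \<in> parcs G})"
    using assms by (simp add: Int_def)
  finally show ?thesis .
qed

text \<open>Count the edges between the spheres of radius l and l + 1 about \<open>x\<close> from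
  both sides.\<close>

lemma valency_rec:
  assumes x: "x \<in> X"
  shows "c (Suc l) * card {z\<in>X. \<partial> x z = Suc l} = b l * card {z\<in>X. \<partial> x z = l}"
proof -
  have "(\<Sum>y\<in>{z\<in>X. \<partial> x z = l}. card {z\<in>{z\<in>X. \<partial> x z = Suc l}. (y, z) \<in> parcs G})
      = (\<Sum>y\<in>{z\<in>X. \<partial> x z = l}. b l)"
  proof (rule sum.cong[OF refl])
    fix y assume "y \<in> {z\<in>X. \<partial> x z = l}"
    moreover have "{z\<in>{z\<in>X. \<partial> x z = Suc l}. (y, z) \<in> parcs G} = {z. (y, z) \<in> parcs G \<and> \<partial> x z = Suc l}"
      by (auto dest: in_arcsD2)
    ultimately show "card {z\<in>{z\<in>X. \<partial> x z = Suc l}. (y, z) \<in> parcs G} = b l"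
      using card_up[OF x, of y] by auto
  qed
  moreover have "(\<Sum>y\<in>{z\<in>X. \<partial> x z = Suc l}. card {z\<in>{z\<in>X. \<partial> x z = l}. (y, z) \<in> parcs G})
      = (\<Sum>y\<in>{z\<in>X. \<partial> x z = Suc l}. c (Suc l))"
  proof (rule sum.cong[OF refl])
    fix y assume "y \<in> {z\<in>X. \<partial> x z = Suc l}"
    moreover have "{z\<in>{z\<in>X. \<partial> x z = l}. (y, z) \<in> parcs G} = {z. (y, z) \<in> parcs G \<and> Suc (\<partial> x z) = Suc l}"
      by (auto dest: in_arcsD2)
    ultimately show "card {z\<in>{z\<in>X. \<partial> x z = l}. (y, z) \<in> parcs G} = c (Suc l)"
      using card_down[OF x, of y] by auto
  qed
  ultimately show ?thesis
    using sum_card_nbrs_swap[of "{z\<in>X. \<partial> x z = l}" "{z\<in>X. \<partial> x z = Suc l}"] by (simp add: mult.commute)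
qed

text \<open>The quadratic form of A_i counts the ordered pairs in \<open>Y\<close> at distance i, so
  a single such pair makes it nonzero.\<close>

lemma graph_dist_le_width:
  assumes "Y \<subseteq> X" "x \<in> Y" "y \<in> Y"
  shows "\<partial> x y \<le> width G Y"
proof -
  let ?i = "\<partial> x y"
  let ?f = "\<lambda>u v. of_bool (u \<in> Y \<and> v \<in> Y \<and> \<partial> u v = ?i) :: nat"
  have "char_form X (dist_mat G ?i) Y = of_nat (\<Sum>u\<in>X. \<Sum>v\<in>X. ?f u v)"
    unfolding char_form_def of_nat_sum by (intro sum.cong refl) (auto simp: dist_mat_def indicator_def)
  moreover have "(\<Sum>u\<in>X. \<Sum>v\<in>X. ?f u v) \<noteq> 0"
  proof
    assume "(\<Sum>u\<in>X. \<Sum>v\<in>X. ?f u v) = 0"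
    then have "?f u v = 0" if "u \<in> X" "v \<in> X" for u v using that by auto
    from this[of x y] show False using assms by auto
  qed
  ultimately have "char_form X (dist_mat G ?i) Y \<noteq> 0" by (simp only: of_nat_eq_0_iff not_False_eq_True)
  then show ?thesis
    unfolding width_def using assms graph_dist_le_diam by (intro Max_ge) auto
qed

lemma char_form_above_dual_width:
  assumes "dual_width G E Y < j" "j \<le> graph_diam G"
  shows "char_form X (E j) Y = 0"
proof (rule ccontr)
  assume "char_form X (E j) Y \<noteq> 0"
  then have "j \<le> dual_width G E Y"
    unfolding dual_width_def using assms(2) by (intro Max_ge) auto
  then show False using assms(1) by simp
qed

end

text \<open>The intersection numbers of the Hamming graph \<open>H(D, m + 1)\<close>.\<close>

locale hamming_parameters = drg +
  fixes m :: nat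
  assumes m_pos: "0 < m"
    and b_eq: "i \<le> graph_diam G \<Longrightarrow> b i = m * (graph_diam G - i)"
    and c_eq: "i \<le> graph_diam G \<Longrightarrow> c i = i"
begin

text \<open>Below the diameter b_l = m (D - l) is positive, so a nonempty sphere is followed by a
  nonempty one.\<close>

lemma valency_pos:
  assumes "x \<in> X"
  shows "l \<le> graph_diam G \<Longrightarrow> 0 < card {z\<in>X. \<partial> x z = l}"
proof (induction l)
  case 0
  have "x \<in> {z\<in>X. \<partial> x z = 0}" using assms graph_dist_self by simp
  then show ?case using card_gt_0_iff by fastforce
next
  case (Suc l)
  then have "0 < b l * card {z\<in>X. \<partial> x z = l}" using m_pos by (simp add: b_eq)
  then show ?case using valency_rec[OF assms, of l] by (metis nat_0_less_mult_iff)
qed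

text \<open>The polynomial \<open>p\<close> is determined up to a scalar by its \<open>D - w\<close> roots \<open>w + 1, \<dots>, D\<close>.\<close>

lemma inner_distribution_rec:
  fixes p :: "complex poly"
  assumes Y: "Y \<subseteq> X" "x \<in> Y" and w: "w \<le> graph_diam G" "\<And>y. y \<in> Y \<Longrightarrow> \<partial> x y \<le> w"
    and p: "degree p \<le> graph_diam G - w"
    and n: "\<And>l. l \<le> graph_diam G \<Longrightarrow>
      of_nat (card {y\<in>Y. \<partial> x y = l}) = of_nat (card {z\<in>X. \<partial> x z = l}) * poly p (of_nat l)"
    and l: "l \<le> w"
  shows "Suc l * card {y\<in>Y. \<partial> x y = Suc l} = m * (w - l) * card {y\<in>Y. \<partial> x y = l}"
proof (cases "l = w")
  case True
  then have "{y\<in>Y. \<partial> x y = Suc l} = {}" using w(2) by fastforce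
  then have "card {y\<in>Y. \<partial> x y = Suc l} = 0" by (simp only: card.empty)
  then show ?thesis using True by simp
next
  case False
  then have lw: "l < w" using l by simp
  let ?D = "graph_diam G"
  define N where "N i = card {y\<in>Y. \<partial> x y = i}" for i
  define k where "k i = card {z\<in>X. \<partial> x z = i}" for i
  have x: "x \<in> X" using Y by blast
  have roots: "poly p (of_nat r) = 0" if r: "r \<in> {Suc w..?D}" for r
  proof -
    have "{y\<in>Y. \<partial> x y = r} = {}" using w(2) r by fastforce
    then have "card {y\<in>Y. \<partial> x y = r} = 0" by (simp only: card.empty)
    then have "of_nat (k r) * poly p (of_nat r) = 0" using n[of r] r unfolding k_def[symmetric] by simp
    moreover have "0 < k r" unfolding k_def by (rule valency_pos[OF x]) (use r in simp)
    ultimately show ?thesis by simp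
  qed
  have "card (of_nat ` {Suc w..?D} :: complex set) = ?D - w"
    by (subst card_image) (auto intro: inj_onI)
  then have "\<exists>a. p = smult a (\<Prod>r\<in>of_nat ` {Suc w..?D}. [:- r, 1:])"
    using p by (intro ex_smult_prod_roots) (auto dest: roots)
  then obtain a where "p = smult a (\<Prod>r\<in>of_nat ` {Suc w..?D}. [:- r, 1:])" by blast
  then have pa: "poly p t = a * (\<Prod>r=Suc w..?D. t - of_nat r)" for t
    by (simp add: poly_prod prod.reindex)
  \<comment> \<open>Up to the factor \<open>a\<close>, these are the values of \<open>p\<close> at l
    and l + 1. After an index shift, \<open>P'\<close> times l - D and \<open>P\<close> times l - w
    are the same product over r = w, ..., D.\<close>
  define P where "P = (\<Prod>r=Suc w..?D. of_nat l - of_nat r :: complex)"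
  define P' where "P' = (\<Prod>r=Suc w..?D. of_nat (Suc l) - of_nat r :: complex)"
  have "P' = (\<Prod>r=w..<?D. of_nat l - of_nat r)"
    unfolding P'_def atLeastLessThanSuc_atLeastAtMost[symmetric] prod.shift_bounds_Suc_ivl by simp
  then have "P' * (of_nat l - of_nat ?D) = (\<Prod>r=w..<Suc ?D. of_nat l - of_nat r)"
    using w(1) by simp
  also have "\<dots> = (of_nat l - of_nat w) * P"
    unfolding P_def atLeastLessThanSuc_atLeastAtMost using w(1) by (simp add: prod.atLeast_Suc_atMost)
  finally have PP': "(of_nat ?D - of_nat l) * P' = (of_nat w - of_nat l) * P"
    by (simp add: algebra_simps)
  have k: "Suc l * k (Suc l) = m * (?D - l) * k l"
    using valency_rec[OF x, of l] lw w(1) by (simp add: k_def b_eq c_eq)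
  have Nl: "complex_of_nat (N l) = of_nat (k l) * (a * P)"
    using n[of l] lw w(1) unfolding N_def k_def pa P_def by simp
  have NSl: "complex_of_nat (N (Suc l)) = of_nat (k (Suc l)) * (a * P')"
    using n[of "Suc l"] lw w(1) unfolding N_def k_def pa P'_def by simp
  have "complex_of_nat (Suc l * N (Suc l)) = of_nat (Suc l * k (Suc l)) * (a * P')"
    unfolding of_nat_mult NSl by simp
  also have "\<dots> = of_nat m * of_nat (k l) * a * ((of_nat ?D - of_nat l) * P')"
    unfolding k using lw w(1) by (simp add: of_nat_diff)
  also have "\<dots> = of_nat m * (of_nat w - of_nat l) * of_nat (N l)"
    unfolding PP' Nl by simp
  also have "\<dots> = of_nat (m * (w - l) * N l)"
    using lw by (simp add: of_nat_diff)
  finally show ?thesis unfolding N_def of_nat_eq_iff .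
qed

text \<open>Counting the edges of \<open>Y\<close> between the spheres of radius \<open>l\<close> and \<open>l + 1\<close> about \<open>x\<close> from
  below and from above gives the same number, so every local estimate is an equality.\<close>

lemma strongly_closed_if_distribution_rec:
  assumes Y: "Y \<subseteq> X" and w: "\<And>x y. x \<in> Y \<Longrightarrow> y \<in> Y \<Longrightarrow> \<partial> x y \<le> w"
    and rec: "\<And>x l. x \<in> Y \<Longrightarrow> l \<le> w \<Longrightarrow>
      Suc l * card {y\<in>Y. \<partial> x y = Suc l} = m * (w - l) * card {y\<in>Y. \<partial> x y = l}"
    and xy: "x \<in> Y" "y \<in> Y" and z: "(y, z) \<in> parcs G" "\<partial> x z \<le> \<partial> x y"
  shows "z \<in> Y"
proof -
  let ?D = "graph_diam G"
  have finY: "finite Y" using Y finite_X finite_subset by blast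
  define l where "l = \<partial> x y"
  define N where "N i = {y\<in>Y. \<partial> x y = i}" for i
  \<comment> \<open>\<open>up u\<close> holds the neighbours of \<open>u\<close> in \<open>Y\<close>
    that are one step farther from \<open>x\<close>; \<open>Z u\<close> holds its neighbours in the
    whole graph that are not farther. The aim is \<open>Z y \<subseteq> Y\<close>.\<close>
  define up where "up u = {v\<in>N (Suc l). (u, v) \<in> parcs G}" for u
  define Z where "Z u = {v. (u, v) \<in> parcs G \<and> \<partial> x v \<le> l}" for u
  have lw: "l \<le> w" using w xy l_def by blast
  have lD: "l \<le> ?D" using xy Y graph_dist_le_diam l_def by blast
  have finN: "finite (N i)" for i using finY by (simp add: N_def)
  have x: "x \<in> X" using Y xy by blast
  \<comment> \<open>The recurrence at l = 0 shows that \<open>Y\<close> induces a regular graph of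
    valency m w.\<close>
  have degY: "card {v\<in>Y. (u, v) \<in> parcs G} = m * w" if "u \<in> Y" for u
  proof -
    have "\<partial> u v = 0 \<longleftrightarrow> u = v" if "v \<in> Y" for v
      using graph_dist_eq_0_iff[of u v] that \<open>u \<in> Y\<close> Y by auto
    then have "{v\<in>Y. \<partial> u v = 0} = {u}" using that by auto
    moreover have "\<partial> u v = Suc 0 \<longleftrightarrow> (u, v) \<in> parcs G" if "v \<in> Y" for v
      using graph_dist_eq_1_iff[of u v] that \<open>u \<in> Y\<close> Y by auto
    then have "{v\<in>Y. \<partial> u v = Suc 0} = {v\<in>Y. (u, v) \<in> parcs G}" by blast
    ultimately show ?thesis using rec[OF that, of 0] by simp
  qed
  have cardZ: "card (Z u) = m * l" if u: "u \<in> N l" for u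
  proof -
    have uX: "u \<in> X" "\<partial> x u = l" using u Y by (auto simp: N_def)
    have "\<partial> x v \<le> Suc l" if "(u, v) \<in> parcs G" for v
      using graph_dist_step[OF x that] uX(2) by simp
    then have "{v. (u, v) \<in> parcs G} = Z u \<union> {v. (u, v) \<in> parcs G \<and> \<partial> x v = Suc l}"
      by (auto simp: Z_def le_Suc_eq)
    moreover have "Z u \<inter> {v. (u, v) \<in> parcs G \<and> \<partial> x v = Suc l} = {}" by (auto simp: Z_def)
    moreover have "finite (Z u)" by (simp add: Z_def)
    ultimately have "b 0 = card (Z u) + b l"
      using degree[OF uX(1)] card_up[OF x uX(1)] uX(2) by (simp add: card_Un_disjoint)
    moreover have "b 0 = m * l + b l"
      using lD by (simp add: b_eq flip: distrib_left)
    ultimately show ?thesis by simp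
  qed
  have split: "card (up u) + card (Z u \<inter> Y) = m * w" if u: "u \<in> N l" for u
  proof -
    have uY: "u \<in> Y" "\<partial> x u = l" using u by (auto simp: N_def)
    have "\<partial> x v \<le> l \<or> \<partial> x v = Suc l" if "(u, v) \<in> parcs G" for v
      using graph_dist_step[OF x that] uY(2) by (simp add: le_Suc_eq)
    then have "{v\<in>Y. (u, v) \<in> parcs G} = up u \<union> (Z u \<inter> Y)"
      unfolding Z_def up_def N_def by blast
    moreover have "up u \<inter> (Z u \<inter> Y) = {}" by (auto simp: Z_def up_def N_def)
    moreover have "finite (up u)" "finite (Z u \<inter> Y)" using finN finY by (auto simp: up_def)
    ultimately show ?thesis using degY[OF uY(1)] by (simp add: card_Un_disjoint)
  qed
  \<comment> \<open>At most m l of the m w neighbours in \<open>Y\<close> lie in \<open>Z u\<close>,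
    so at least m (w - l) go up.\<close>
  have low: "m * (w - l) \<le> card (up u)" if u: "u \<in> N l" for u
  proof -
    have "card (Z u \<inter> Y) \<le> m * l"
      using card_mono[of "Z u" "Z u \<inter> Y"] cardZ[OF u] by (simp add: Z_def)
    then show ?thesis using split[OF u] by (simp add: diff_mult_distrib2)
  qed
  have "(\<Sum>u\<in>N l. card (up u)) = (\<Sum>v\<in>N (Suc l). card {u\<in>N l. (v, u) \<in> parcs G})"
    unfolding up_def by (intro sum_card_nbrs_swap finN)
  also have "\<dots> \<le> (\<Sum>v\<in>N (Suc l). Suc l)"
  proof (rule sum_mono)
    fix v assume v: "v \<in> N (Suc l)"
    then have vX: "v \<in> X" "\<partial> x v = Suc l" using Y by (auto simp: N_def)
    then have "Suc l \<le> ?D" using graph_dist_le_diam x by metis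
    then have "card {u. (v, u) \<in> parcs G \<and> Suc (\<partial> x u) = Suc l} = Suc l"
      using card_down[OF x vX(1)] vX(2) by (simp add: c_eq)
    moreover have "card {u\<in>N l. (v, u) \<in> parcs G} \<le> card {u. (v, u) \<in> parcs G \<and> Suc (\<partial> x u) = Suc l}"
      by (intro card_mono) (auto simp: N_def)
    ultimately show "card {u\<in>N l. (v, u) \<in> parcs G} \<le> Suc l" by simp
  qed
  \<comment> \<open>The recurrence turns the upper bound, obtained from c_{l+1} = l + 1, into the
    sum of the lower bounds \<open>low\<close>; hence each of these is attained.\<close>
  also have "\<dots> = (\<Sum>u\<in>N l. m * (w - l))"
    using rec[OF xy(1) lw] by (simp add: N_def mult.commute)
  finally have le: "(\<Sum>u\<in>N l. card (up u)) \<le> (\<Sum>u\<in>N l. m * (w - l))" .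
  have yN: "y \<in> N l" using xy by (simp add: N_def l_def)
  have "card (up y) = m * (w - l)"
  proof (rule ccontr)
    assume "card (up y) \<noteq> m * (w - l)"
    then have "m * (w - l) < card (up y)" using low[OF yN] by simp
    then have "(\<Sum>u\<in>N l. m * (w - l)) < (\<Sum>u\<in>N l. card (up u))"
      using low yN finN by (intro sum_strict_mono_ex1) auto
    then show False using le by simp
  qed
  moreover have "m * w = m * l + m * (w - l)"
    using lw by (simp flip: distrib_left)
  ultimately have "card (Z y \<inter> Y) = card (Z y)"
    using split[OF yN] cardZ[OF yN] by linarith
  moreover have "finite (Z y)" by (simp add: Z_def)
  ultimately have "Z y \<inter> Y = Z y"
    by (intro card_subset_eq Int_lower1)
  moreover have "z \<in> Z y" using z by (simp add: Z_def l_def)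
  ultimately show ?thesis by blast
qed

end

section \<open>Specialisation to classical parameters (d, 1, 0, m)\<close>

lemma gauss_int_1 [simp]: "gauss_int i 1 = real i"
  by (simp add: gauss_int_def)

text \<open>For q = 1 and \<alpha> = 0 the intersection numbers are those of a Hamming graph and the
  dual eigenvalues are affine in the distance. So the outer distribution polynomials have degree at
  most the dual width, which is D - w for a descendent of width w.\<close>

theorem descendent_strongly_closed:
  assumes std: "standard_ordering G d 1 0 (real m) E" and "0 < d" "0 < m"
    and desc: "descendent G E Y" and xy: "x \<in> Y" "y \<in> Y"
    and z: "(y, z) \<in> parcs G" "graph_dist G x z \<le> graph_dist G x y"
  shows "z \<in> Y"
proof -
  have cp: "has_classical_parameters G d 1 0 (real m)" and Q: "Q_polynomial_ordering G E"
    using std unfolding standard_ordering_def by blast+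
  then obtain b c where inter: "has_intersection_numbers G b c" and D: "graph_diam G = d"
    and gauss: "\<forall>i\<le>d. real (b i) = (gauss_int d 1 - gauss_int i 1) * (real m - 0 * gauss_int i 1) \<and>
      real (c i) = gauss_int i 1 * (1 + 0 * gauss_int (i - 1) 1)"
    unfolding has_classical_parameters_def by blast
  have bc: "real (b i) = (real d - real i) * real m \<and> real (c i) = real i" if "i \<le> d" for i
    using gauss[rule_format, OF that] by simp
  have b: "b i = m * (d - i)" if "i \<le> d" for i
  proof -
    have "real (b i) = real (m * (d - i))" using bc[OF that] that by (simp add: of_nat_diff)
    then show ?thesis by (simp only: of_nat_eq_iff)
  qed
  have pg: "pair_graph G" and conn: "Digraph_Component.connected (with_proj G)"
    using inter by (auto simp: has_intersection_numbers_def)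
  interpret pair_graph G by (rule pg)
  interpret hamming_parameters G b c m
    using inter conn bc b D \<open>0 < m\<close> by unfold_locales simp_all
  obtain \<theta> \<xi> \<zeta> where E1: "(\<lambda>x y. of_nat (card X) * E 1 x y) = (\<lambda>x y. \<Sum>i\<le>d. \<theta> i * dist_mat G i x y)"
    and \<xi>: "\<xi> \<noteq> 0" and \<theta>: "\<And>i. i \<le> d \<Longrightarrow> \<theta> i = \<xi> * of_nat (d - i) + \<zeta>"
    using std unfolding standard_ordering_def by auto
  \<comment> \<open>This is \<xi> (d - i) + \<zeta> as a polynomial in i, divided by |X|; its degree
    is 1 because \<xi> is nonzero.\<close>
  define p1 where "p1 = [:(\<xi> * of_nat d + \<zeta>) / of_nat (card X), - \<xi> / of_nat (card X):]"
  have n: "card X \<noteq> 0" using X_nonempty by simp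
  have "E 1 x y = bm_poly p1 x y" for x y
  proof -
    have "of_nat (card X) * E 1 x y = bm \<theta> x y"
      using fun_cong[OF fun_cong[OF E1, of x], of y] fun_cong[OF fun_cong[OF sum_dist_mat[of \<theta>], of x], of y] D
      by simp
    then have "E 1 x y = bm \<theta> x y / of_nat (card X)" using n by (simp add: field_simps)
    moreover have "\<theta> i / of_nat (card X) = poly p1 (of_nat i)" if "i \<le> d" for i
      unfolding \<theta>[OF that] using that
      by (simp add: p1_def of_nat_diff add_divide_distrib diff_divide_distrib algebra_simps)
    ultimately show ?thesis
      using graph_dist_le_diam D by (simp add: bm_def)
  qed
  then have E1': "E 1 = bm_poly p1" by blast
  have deg1: "degree p1 = 1" using \<xi> n by (simp add: p1_def)
  obtain P where P: "\<forall>j\<le>graph_diam G. degree (P j) = j \<and> P j \<noteq> 0 \<and> E j = bm_poly (P j)"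
    using Q_polynomial_ordering_polys[OF Q E1' deg1] by blast
  have ord: "idempotent_ordering G E" using Q by (simp add: Q_polynomial_ordering_def)
  have Y: "Y \<subseteq> X" and ww: "width G Y + dual_width G E Y = graph_diam G"
    using desc by (auto simp: descendent_def)
  have rec: "Suc l * card {y\<in>Y. \<partial> x y = Suc l} = m * (width G Y - l) * card {y\<in>Y. \<partial> x y = l}"
    if x: "x \<in> Y" and l: "l \<le> width G Y" for x l
  proof -
    have "x \<in> X" using Y x by blast
    then obtain p :: "complex poly" where p: "degree p \<le> dual_width G E Y"
      "\<And>l. l \<le> graph_diam G \<Longrightarrow>
        of_nat (card {y\<in>Y. \<partial> x y = l}) = of_nat (card {z\<in>X. \<partial> x z = l}) * poly p (of_nat l)"
      using outer_distribution[OF ord, of P Y "dual_width G E Y" x] P Y char_form_above_dual_width[of E Y] ww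
      by auto
    show ?thesis
      by (rule inner_distribution_rec[OF Y x _ _ _ p(2) l])
        (use ww p(1) graph_dist_le_width[OF Y x] in auto)
  qed
  show ?thesis
    using strongly_closed_if_distribution_rec[OF Y graph_dist_le_width[OF Y] rec xy z] .
qed


section \<open>Strongly closed subsets of Cartesian products\<close>

lemma sum_fun_upd_add:
  fixes f :: "'i \<Rightarrow> 'a \<Rightarrow> 'b :: comm_monoid_add"
  assumes "finite I" "i \<in> I"
  shows "(\<Sum>j\<in>I. f j ((y(i := t)) j)) = f i t + (\<Sum>j\<in>I - {i}. f j (y j))"
proof -
  have "(\<Sum>j\<in>I. f j ((y(i := t)) j)) = f i t + (\<Sum>j\<in>I - {i}. f j ((y(i := t)) j))"
    using assms by (simp add: sum.remove[of I i])
  also have "(\<Sum>j\<in>I - {i}. f j ((y(i := t)) j)) = (\<Sum>j\<in>I - {i}. f j (y j))"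
    by (intro sum.cong) auto
  finally show ?thesis .
qed

lemma sum_remove_add:
  fixes f :: "'i \<Rightarrow> 'a \<Rightarrow> 'b :: comm_monoid_add"
  assumes "finite I" "i \<in> I"
  shows "(\<Sum>j\<in>I. f j (y j)) = f i (y i) + (\<Sum>j\<in>I - {i}. f j (y j))"
  using sum_fun_upd_add[OF assms, of f y "y i"] unfolding fun_upd_triv .

text \<open>\<open>\<delta> i\<close> plays the role of the distance function of the factor \<open>H i\<close>; the conditions are those
  of \<open>pair_graph.graph_dist_eqI\<close>.\<close>

locale product_distance =
  fixes I :: "'i set" and H :: "'i \<Rightarrow> 'a pair_pre_digraph" and \<delta> :: "'i \<Rightarrow> 'a \<Rightarrow> 'a \<Rightarrow> nat"
  assumes finite_I: "finite I"
    and self: "i \<in> I \<Longrightarrow> \<delta> i u u = 0"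
    and step: "i \<in> I \<Longrightarrow> a \<in> pverts (H i) \<Longrightarrow> (u, v) \<in> parcs (H i) \<Longrightarrow> \<delta> i a v \<le> Suc (\<delta> i a u)"
    and descend: "i \<in> I \<Longrightarrow> a \<in> pverts (H i) \<Longrightarrow> v \<in> pverts (H i) \<Longrightarrow> v \<noteq> a \<Longrightarrow>
      \<exists>u\<in>pverts (H i). (v, u) \<in> parcs (H i) \<and> \<delta> i a v = Suc (\<delta> i a u)"
    and pair_graph_product: "pair_graph (cartesian_product I H)"
begin

abbreviation "V \<equiv> (\<Pi>\<^sub>E i\<in>I. pverts (H i))"

lemma pverts_product: "pverts (cartesian_product I H) = V"
  by (simp add: cartesian_product_def)

lemma upd_in_V: "y \<in> V \<Longrightarrow> i \<in> I \<Longrightarrow> t \<in> pverts (H i) \<Longrightarrow> y(i := t) \<in> V"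
  using PiE_fun_upd[of t "\<lambda>i. pverts (H i)" i y I] by (simp add: insert_absorb)

lemma upd_arc:
  assumes "y \<in> V" "i \<in> I" "t \<in> pverts (H i)" "(y i, t) \<in> parcs (H i)"
  shows "(y, y(i := t)) \<in> parcs (cartesian_product I H)"
proof -
  have "y(i := t) \<in> V" using assms upd_in_V by blast
  moreover have "(y i, (y(i := t)) i) \<in> parcs (H i) \<and> (\<forall>j\<in>I - {i}. y j = (y(i := t)) j)"
    using assms by simp
  ultimately show ?thesis using assms(1,2) unfolding cartesian_product_def by fastforce
qed

text \<open>The sum of the coordinate distances meets the distance criterion: an arc changes only
  one coordinate, and any coordinate where \<open>y\<close> differs from \<open>x\<close> can be
  moved one step closer.\<close>

lemma graph_dist_product:
  assumes x: "x \<in> V" and y: "y \<in> V"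
  shows "graph_dist (cartesian_product I H) x y = (\<Sum>i\<in>I. \<delta> i (x i) (y i))"
proof (rule pair_graph.graph_dist_eqI[OF pair_graph_product])
  show "x \<in> pverts (cartesian_product I H)" "y \<in> pverts (cartesian_product I H)"
    using x y by (simp_all add: pverts_product)
  show "(\<Sum>i\<in>I. \<delta> i (x i) (x i)) = 0" by (simp add: self)
next
  fix y z assume "(y, z) \<in> parcs (cartesian_product I H)"
  then obtain i where i: "i \<in> I" "(y i, z i) \<in> parcs (H i)" "\<forall>j\<in>I - {i}. y j = z j"
    unfolding cartesian_product_def by auto
  have "x i \<in> pverts (H i)" using x i(1) by blast
  then have "\<delta> i (x i) (z i) \<le> Suc (\<delta> i (x i) (y i))" using step i by blast
  moreover have "(\<Sum>j\<in>I - {i}. \<delta> j (x j) (y j)) = (\<Sum>j\<in>I - {i}. \<delta> j (x j) (z j))"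
    using i(3) by (intro sum.cong) auto
  ultimately show "(\<Sum>i\<in>I. \<delta> i (x i) (z i)) \<le> Suc (\<Sum>i\<in>I. \<delta> i (x i) (y i))"
    using sum_remove_add[OF finite_I i(1), of "\<lambda>j. \<delta> j (x j)" z]
      sum_remove_add[OF finite_I i(1), of "\<lambda>j. \<delta> j (x j)" y] by simp
next
  fix y assume "y \<in> pverts (cartesian_product I H)" and ne: "y \<noteq> x"
  then have y: "y \<in> V" by (simp add: pverts_product)
  obtain i where i: "i \<in> I" "y i \<noteq> x i" using PiE_ext[OF y x] ne by blast
  moreover have "x i \<in> pverts (H i)" "y i \<in> pverts (H i)" using x y i(1) by blast+
  ultimately obtain u where u: "u \<in> pverts (H i)" "(y i, u) \<in> parcs (H i)"
    "\<delta> i (x i) (y i) = Suc (\<delta> i (x i) u)" using descend by blast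
  have "(y, y(i := u)) \<in> parcs (cartesian_product I H)" using upd_arc y i u by blast
  then have "(y(i := u), y) \<in> parcs (cartesian_product I H)"
  proof -
    interpret pair_graph "cartesian_product I H" by (rule pair_graph_product)
    show ?thesis using arcs_symmetric \<open>(y, y(i := u)) \<in> parcs (cartesian_product I H)\<close> by blast
  qed
  moreover have "(\<Sum>j\<in>I. \<delta> j (x j) (y j)) = Suc (\<Sum>j\<in>I. \<delta> j (x j) ((y(i := u)) j))"
    using sum_fun_upd_add[OF finite_I i(1), of "\<lambda>j. \<delta> j (x j)" y u] u(3)
      sum_remove_add[OF finite_I i(1), of "\<lambda>j. \<delta> j (x j)" y] by simp
  ultimately show "\<exists>z. (z, y) \<in> parcs (cartesian_product I H) \<and>
      (\<Sum>j\<in>I. \<delta> j (x j) (y j)) = Suc (\<Sum>j\<in>I. \<delta> j (x j) (z j))" by blast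
qed

text \<open>Coordinates of elements of \<open>Y\<close> can be exchanged freely, so \<open>Y\<close>
  is the product of its projections; a closure step in one projection lifts to
  \<open>Y\<close>.\<close>

lemma strongly_closed_product:
  assumes Y: "Y \<subseteq> V" "Y \<noteq> {}"
    and closed: "\<And>x y z. x \<in> Y \<Longrightarrow> y \<in> Y \<Longrightarrow> (y, z) \<in> parcs (cartesian_product I H) \<Longrightarrow>
      graph_dist (cartesian_product I H) x z \<le> graph_dist (cartesian_product I H) x y \<Longrightarrow> z \<in> Y"
  shows "\<exists>Z. Y = (\<Pi>\<^sub>E i\<in>I. Z i) \<and> (\<forall>i\<in>I. Z i \<noteq> {} \<and> Z i \<subseteq> pverts (H i) \<and>
    (\<forall>u\<in>Z i. \<forall>v\<in>Z i. \<forall>t\<in>pverts (H i). (v, t) \<in> parcs (H i) \<longrightarrow> \<delta> i u t \<le> \<delta> i u v \<longrightarrow> t \<in> Z i))"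
proof -
  \<comment> \<open>A change in coordinate \<open>i\<close> leaves the other summands of the
    distance alone, so only the distances in that coordinate need be compared.\<close>
  have closed': "y(i := t) \<in> Y"
    if "x \<in> Y" "y \<in> Y" "i \<in> I" "t \<in> pverts (H i)" "(y i, t) \<in> parcs (H i)" "\<delta> i (x i) t \<le> \<delta> i (x i) (y i)"
    for x y i t
  proof (rule closed[OF that(1,2)])
    have yV: "y \<in> V" and xV: "x \<in> V" using that Y by auto
    show "(y, y(i := t)) \<in> parcs (cartesian_product I H)" using upd_arc yV that by blast
    show "graph_dist (cartesian_product I H) x (y(i := t)) \<le> graph_dist (cartesian_product I H) x y"
      unfolding graph_dist_product[OF xV upd_in_V[OF yV that(3,4)]] graph_dist_product[OF xV yV]
        sum_fun_upd_add[OF finite_I that(3), of "\<lambda>j. \<delta> j (x j)"]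
        sum_remove_add[OF finite_I that(3), of "\<lambda>j. \<delta> j (x j)" y]
      using that(6) by simp
  qed
  \<comment> \<open>Walk coordinate \<open>i\<close> of \<open>y\<close> towards \<open>x i\<close>:
    each step lowers the distance to \<open>x\<close> and so stays inside \<open>Y\<close>.\<close>
  have mix: "y(i := x i) \<in> Y" if "x \<in> Y" "y \<in> Y" "i \<in> I" for x y i
    using that
  proof (induction "\<delta> i (x i) (y i)" arbitrary: y rule: less_induct)
    case less
    show ?case
    proof (cases "y i = x i")
      case True
      then show ?thesis using less.prems by (simp add: fun_upd_idem)
    next
      case False
      moreover have "x i \<in> pverts (H i)" "y i \<in> pverts (H i)" using less.prems Y by auto
      ultimately obtain u where u: "u \<in> pverts (H i)" "(y i, u) \<in> parcs (H i)"
        "\<delta> i (x i) (y i) = Suc (\<delta> i (x i) u)" using descend less.prems(3) by blast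
      then have "y(i := u) \<in> Y" using closed'[OF less.prems u(1,2)] by simp
      then have "(y(i := u))(i := x i) \<in> Y"
        using less.hyps[of "y(i := u)"] less.prems u(3) by simp
      then show ?thesis by simp
    qed
  qed
  define Z where "Z i = (\<lambda>x. x i) ` Y" for i
  have Z: "Z i \<noteq> {} \<and> Z i \<subseteq> pverts (H i)" if "i \<in> I" for i
    using Y that by (auto simp: Z_def)
  have "f \<in> Y" if f: "f \<in> (\<Pi>\<^sub>E i\<in>I. Z i)" for f
  proof -
    \<comment> \<open>Starting from any element of \<open>Y\<close>, coordinates are replaced one
      after another by those of \<open>f\<close>.\<close>
    have "\<exists>y\<in>Y. \<forall>i\<in>J. y i = f i" if "finite J" "J \<subseteq> I" for J
      using that
    proof (induction J)
      case empty
      then show ?case using Y(2) by blast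
    next
      case (insert i J)
      then obtain y where y: "y \<in> Y" "\<forall>j\<in>J. y j = f j" by blast
      have "f i \<in> Z i" using f insert.prems by blast
      then obtain x where x: "x \<in> Y" "x i = f i" unfolding Z_def by fastforce
      then have "y(i := x i) \<in> Y" using mix y insert.prems by blast
      then show ?case using y x by (intro bexI[of _ "y(i := x i)"]) auto
    qed
    then obtain y where y: "y \<in> Y" "\<forall>i\<in>I. y i = f i" using finite_I by blast
    have "y \<in> V" "f \<in> V" using y(1) Y(1) f PiE_mono[of I Z "\<lambda>i. pverts (H i)"] Z by blast+
    then have "y = f" using y(2) by (intro PiE_ext[of y I _ f]) auto
    then show ?thesis using y by simp
  qed
  moreover have "Y \<subseteq> (\<Pi>\<^sub>E i\<in>I. Z i)" using Y(1) by (auto simp: Z_def PiE_iff)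
  ultimately have "Y = (\<Pi>\<^sub>E i\<in>I. Z i)" by blast
  moreover have "t \<in> Z i" if i: "i \<in> I" and uv: "u \<in> Z i" "v \<in> Z i" and t: "t \<in> pverts (H i)"
    "(v, t) \<in> parcs (H i)" "\<delta> i u t \<le> \<delta> i u v" for i u v t
  proof -
    obtain x y where xy: "x \<in> Y" "x i = u" "y \<in> Y" "y i = v" using uv unfolding Z_def by blast
    have "y(i := t) \<in> Y" using closed'[of x y i t] xy i t by simp
    then have "(y(i := t)) i \<in> Z i" unfolding Z_def by (rule imageI)
    then show ?thesis by simp
  qed
  ultimately show ?thesis using Z by (intro exI[of _ Z]) blast
qed

end


section \<open>The factors of the Doob graph\<close>

text \<open>The distance function of a graph of diameter at most two.\<close>

definition dist2 :: "'a pair_pre_digraph \<Rightarrow> 'a \<Rightarrow> 'a \<Rightarrow> nat" where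
  "dist2 H u v = (if u = v then 0 else if (u, v) \<in> parcs H then 1 else 2)"

lemma exhaust_mod_4: "(x :: 4) = 0 \<or> x = 1 \<or> x = 2 \<or> x = 3"
proof -
  have "card {0, 1, 2, 3 :: 4} = CARD(4)" by simp
  then have "{0, 1, 2, 3 :: 4} = UNIV" by (intro card_subset_eq) auto
  then show ?thesis by blast
qed

lemma uminus_1_mod_4: "- 1 = (3 :: 4)"
  by (rule minus_unique) simp

lemma dist2_step: "(u, v) \<in> parcs H \<Longrightarrow> dist2 H a v \<le> Suc (dist2 H a u)"
  by (auto simp: dist2_def)

lemma dist2_image:
  assumes "inj f"
  shows "dist2 (image_graph f H) (f u) (f v) = dist2 H u v"
proof -
  have "(f u, f v) \<in> map_prod f f ` parcs H \<longleftrightarrow> (u, v) \<in> parcs H"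
    using assms by (auto dest: injD)
  then show ?thesis using assms by (simp add: dist2_def image_graph_def inj_eq)
qed

text \<open>Phrased by arcs rather than by \<open>graph_dist\<close>, so that it can be checked by
  finite computation and transported along injections.\<close>

definition diameter_le_2 :: "'a pair_pre_digraph \<Rightarrow> bool" where
  "diameter_le_2 H \<longleftrightarrow> irrefl (parcs H) \<and> sym (parcs H) \<and> parcs H \<subseteq> pverts H \<times> pverts H \<and>
    (\<forall>a\<in>pverts H. \<forall>v\<in>pverts H. a \<noteq> v \<longrightarrow> (a, v) \<notin> parcs H \<longrightarrow>
      (\<exists>u. (a, u) \<in> parcs H \<and> (u, v) \<in> parcs H))"

lemma diameter_le_2_descend:
  assumes H: "diameter_le_2 H" and av: "a \<in> pverts H" "v \<in> pverts H" "v \<noteq> a"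
  shows "\<exists>u\<in>pverts H. (v, u) \<in> parcs H \<and> dist2 H a v = Suc (dist2 H a u)"
proof (cases "(a, v) \<in> parcs H")
  case True
  then have "(v, a) \<in> parcs H" using H by (auto simp: diameter_le_2_def dest: symD)
  then show ?thesis using True av by (intro bexI[of _ a]) (auto simp: dist2_def)
next
  case False
  then obtain u where u: "(a, u) \<in> parcs H" "(u, v) \<in> parcs H"
    using H av unfolding diameter_le_2_def by metis
  then have "(v, u) \<in> parcs H" "u \<in> pverts H" "u \<noteq> a"
    using H by (auto simp: diameter_le_2_def irrefl_def dest: symD)
  then show ?thesis using False u av by (intro bexI[of _ u]) (auto simp: dist2_def)
qed

lemma diameter_le_2_image:
  assumes "inj f" and H: "diameter_le_2 H"
  shows "diameter_le_2 (image_graph f H)"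
  unfolding diameter_le_2_def
proof (intro conjI ballI impI)
  let ?P = "pverts (image_graph f H)" and ?A = "parcs (image_graph f H)"
  have arc: "(f u, f v) \<in> ?A \<longleftrightarrow> (u, v) \<in> parcs H" for u v
    using assms(1) by (auto simp: image_graph_def dest: injD)
  show "irrefl ?A"
    using H assms(1) by (auto simp: diameter_le_2_def irrefl_def image_graph_def dest: injD)
  show "sym ?A"
    using H by (auto simp: diameter_le_2_def sym_def image_graph_def)
  show "?A \<subseteq> ?P \<times> ?P"
    using H by (auto simp: diameter_le_2_def image_graph_def)
  fix a v assume "a \<in> ?P" "v \<in> ?P" and ne: "a \<noteq> v" "(a, v) \<notin> ?A"
  then obtain a' v' where av: "a = f a'" "v = f v'" "a' \<in> pverts H" "v' \<in> pverts H"
    by (auto simp: image_graph_def)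
  then have "a' \<noteq> v'" "(a', v') \<notin> parcs H" using ne arc by auto
  then obtain u where "(a', u) \<in> parcs H" "(u, v') \<in> parcs H"
    using H av unfolding diameter_le_2_def by metis
  then show "\<exists>u. (a, u) \<in> ?A \<and> (u, v) \<in> ?A"
    unfolding av using arc by blast
qed

section \<open>The Shrikhande graph\<close>

definition shrikhande_set :: "(4 \<times> 4) set" where
  "shrikhande_set = {(1, 0), - (1, 0), (0, 1), - (0, 1), (1, 1), - (1, 1)}"

lemma shrikhande_set_eq: "shrikhande_set = {(1, 0), (3, 0), (0, 1), (0, 3), (1, 1), (3, 3)}"
  unfolding shrikhande_set_def uminus_Pair uminus_1_mod_4 minus_zero ..

lemma pverts_shrikhande: "pverts shrikhande = UNIV"
  by (simp add: shrikhande_def cayley_graph_def)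

lemma shrikhande_arcs: "(x, y) \<in> parcs shrikhande \<longleftrightarrow> y - x \<in> shrikhande_set"
  unfolding shrikhande_def cayley_graph_def shrikhande_set_def[symmetric] by simp

lemma shrikhande_set_cases:
  assumes "s \<in> shrikhande_set"
  obtains "s = (1, 0)" | "s = (3, 0)" | "s = (0, 1)" | "s = (0, 3)" | "s = (1, 1)" | "s = (3, 3)"
  using assms unfolding shrikhande_set_eq by blast

lemma shrikhande_set_uminus: "s \<in> shrikhande_set \<Longrightarrow> - s \<in> shrikhande_set"
  unfolding shrikhande_set_def by (elim insertE emptyE) (simp_all only: minus_minus insert_iff simp_thms)

lemma mod_4_arith:
  "(0::4) - 1 = 3" "(0::4) - 2 = 2" "(0::4) - 3 = 1" "(1::4) - 2 = 3" "(1::4) - 3 = 2"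
  "(2::4) - 1 = 1" "(2::4) - 3 = 3" "(3::4) - 1 = 2" "(3::4) - 2 = 1" "(1::4) + 1 = 2" "(3::4) + 3 = 2"
  by simp_all

text \<open>Besides 0 and the six connection elements there are nine differences, each listed as a
  sum of two connection elements. So the diameter is at most two.\<close>

lemma shrikhande_diff_cases:
  "d = 0 \<or> d \<in> shrikhande_set \<or> (\<exists>s\<in>shrikhande_set. d - s \<in> shrikhande_set)"
proof -
  have far: "d = s + t \<Longrightarrow> s \<in> shrikhande_set \<Longrightarrow> t \<in> shrikhande_set \<Longrightarrow> ?thesis" for s t
    by (rule disjI2, rule disjI2, rule bexI[of _ s]) simp_all
  obtain i j where d: "d = (i, j)" by (cases d)
  consider "d = 0" | "d \<in> shrikhande_set"
    | "d = (1, 0) + (1, 0)"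
    | "d = (0, 1) + (0, 1)"
    | "d = (1, 1) + (1, 1)"
    | "d = (0, 1) + (1, 1)"
    | "d = (1, 0) + (1, 1)"
    | "d = (1, 0) + (0, 3)"
    | "d = (3, 0) + (0, 1)"
    | "d = (3, 3) + (3, 0)"
    | "d = (3, 3) + (0, 3)"
    using exhaust_mod_4[of i] exhaust_mod_4[of j] unfolding d shrikhande_set_eq zero_prod_def
    by (elim disjE) (simp_all add: mod_4_arith)
  then show ?thesis
    by cases (blast | (erule far; simp add: shrikhande_set_eq))+
qed

text \<open>The two common neighbours of \<open>0\<close> and \<open>s\<close> are not adjacent.\<close>

lemma shrikhande_common_nbrs:
  assumes "s \<in> shrikhande_set"
  shows "\<exists>t\<in>shrikhande_set. \<exists>t'\<in>shrikhande_set.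
    s - t \<in> shrikhande_set \<and> s - t' \<in> shrikhande_set \<and> t' - t \<notin> shrikhande_set \<and> t' \<noteq> t"
  using assms
proof (cases rule: shrikhande_set_cases)
  case 1
  then show ?thesis
    by (intro bexI[of _ "(1, 1)"] bexI[of _ "(0, 3)"]) (simp_all add: shrikhande_set_eq mod_4_arith)
next
  case 2
  then show ?thesis
    by (intro bexI[of _ "(3, 3)"] bexI[of _ "(0, 1)"]) (simp_all add: shrikhande_set_eq mod_4_arith)
next
  case 3
  then show ?thesis
    by (intro bexI[of _ "(1, 1)"] bexI[of _ "(3, 0)"]) (simp_all add: shrikhande_set_eq mod_4_arith)
next
  case 4
  then show ?thesis
    by (intro bexI[of _ "(3, 3)"] bexI[of _ "(1, 0)"]) (simp_all add: shrikhande_set_eq mod_4_arith)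
next
  case 5
  then show ?thesis
    by (intro bexI[of _ "(1, 0)"] bexI[of _ "(0, 1)"]) (simp_all add: shrikhande_set_eq mod_4_arith)
next
  case 6
  then show ?thesis
    by (intro bexI[of _ "(3, 0)"] bexI[of _ "(0, 3)"]) (simp_all add: shrikhande_set_eq mod_4_arith)
qed

text \<open>Meant for the neighbours q + s and q - s of a vertex q: their difference is s + s, so
  they are at distance two.\<close>

lemma shrikhande_double: "s \<in> shrikhande_set \<Longrightarrow> s + s \<notin> shrikhande_set \<and> s + s \<noteq> 0"
  by (erule shrikhande_set_cases) (simp_all add: shrikhande_set_eq mod_4_arith zero_prod_def)

lemma diameter_le_2_shrikhande: "diameter_le_2 shrikhande"
  unfolding diameter_le_2_def pverts_shrikhande
proof (intro conjI ballI impI)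
  show "irrefl (parcs shrikhande)"
    by (simp add: irrefl_def shrikhande_arcs shrikhande_set_eq zero_prod_def)
  show "sym (parcs shrikhande)"
    using shrikhande_set_uminus unfolding sym_def shrikhande_arcs by (metis minus_diff_eq)
  fix a v :: "4 \<times> 4" assume "a \<noteq> v" "(a, v) \<notin> parcs shrikhande"
  then obtain s where "s \<in> shrikhande_set" "v - a - s \<in> shrikhande_set"
    using shrikhande_diff_cases[of "v - a"] by (auto simp: shrikhande_arcs)
  then show "\<exists>u. (a, u) \<in> parcs shrikhande \<and> (u, v) \<in> parcs shrikhande"
    unfolding shrikhande_arcs by (intro exI[of _ "a + s"]) (simp add: algebra_simps)
qed simp

lemma diameter_le_2_K4: "diameter_le_2 K4"
  by (auto simp: diameter_le_2_def K4_def complete_graph_def irrefl_def sym_def)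

text \<open>Two vertices at distance two force all their neighbours into the set, and every vertex
  \<open>v + s\<close> so obtained is again at distance two from \<open>v - s\<close>.\<close>

lemma shrikhande_strongly_closed:
  assumes uv: "u \<in> Z" "v \<in> Z" "u \<noteq> v"
    and closed: "\<And>u v t. u \<in> Z \<Longrightarrow> v \<in> Z \<Longrightarrow> (v, t) \<in> parcs shrikhande \<Longrightarrow>
      dist2 shrikhande u t \<le> dist2 shrikhande u v \<Longrightarrow> t \<in> Z"
  shows "Z = UNIV"
proof -
  \<comment> \<open>Vertices of \<open>Z\<close> with a partner in \<open>Z\<close> at distance two.
    This set is nonempty and closed under adding connection elements, hence everything.\<close>
  define M where "M = {v\<in>Z. \<exists>p\<in>Z. v \<noteq> p \<and> v - p \<notin> shrikhande_set}"
  have "\<exists>p\<in>Z. \<exists>q\<in>Z. p \<noteq> q \<and> p - q \<notin> shrikhande_set"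
  proof (cases "v - u \<in> shrikhande_set")
    case False
    then show ?thesis using uv by (intro bexI[of _ v] bexI[of _ u]) simp_all
  next
    case True
    then obtain t t' where t: "t \<in> shrikhande_set" "t' \<in> shrikhande_set" "v - u - t \<in> shrikhande_set"
      "v - u - t' \<in> shrikhande_set" "t' - t \<notin> shrikhande_set" "t' \<noteq> t"
      using shrikhande_common_nbrs[OF True] by blast
    \<comment> \<open>\<open>u + r\<close> is a common neighbour of the adjacent vertices
      \<open>u\<close> and \<open>v\<close>, so no farther from \<open>u\<close> than
      \<open>v\<close> is. The choices \<open>t\<close> and \<open>t'\<close> then give a pair at
      distance two.\<close>
    have "u + r \<in> Z" if r: "r \<in> shrikhande_set" "v - u - r \<in> shrikhande_set" for r
    proof (rule closed[OF uv(1,2)])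
      have "- (v - u - r) \<in> shrikhande_set" using r shrikhande_set_uminus by blast
      moreover have "u + r - v = - (v - u - r)" by simp
      ultimately show "(v, u + r) \<in> parcs shrikhande" by (simp only: shrikhande_arcs)
      show "dist2 shrikhande u (u + r) \<le> dist2 shrikhande u v"
        using r(1) uv(3) by (simp add: dist2_def shrikhande_arcs)
    qed
    then have "u + t \<in> Z" "u + t' \<in> Z" using t by blast+
    then show ?thesis using t by (intro bexI[of _ "u + t'"] bexI[of _ "u + t"]) simp_all
  qed
  then obtain p where p: "p \<in> M" unfolding M_def by blast
  have add: "q + s \<in> M" if q: "q \<in> M" and s: "s \<in> shrikhande_set" for q s
  proof -
    obtain r where r: "q \<in> Z" "r \<in> Z" "q \<noteq> r" "q - r \<notin> shrikhande_set"
      using q unfolding M_def by blast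
    have two: "dist2 shrikhande r q = 2" using r by (simp add: dist2_def shrikhande_arcs)
    \<comment> \<open>As \<open>dist2\<close> never exceeds 2, every neighbour of \<open>q\<close>
      is at most as far from \<open>r\<close> as \<open>q\<close> is.\<close>
    have nbr: "q + s' \<in> Z" if "s' \<in> shrikhande_set" for s'
      using that by (intro closed[OF r(2,1)]) (simp_all add: shrikhande_arcs two, simp add: dist2_def)
    have "q + s \<in> Z" "q - s \<in> Z"
      using nbr[OF s] nbr[OF shrikhande_set_uminus[OF s]] by simp_all
    moreover have diff: "(q + s) - (q - s) = s + s" by simp
    moreover have "q + s \<noteq> q - s"
    proof
      assume "q + s = q - s"
      then have "s + s = 0" using diff by (simp only: diff_self)
      then show False using shrikhande_double[OF s] by blast
    qed
    moreover have "(q + s) - (q - s) \<notin> shrikhande_set"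
      unfolding diff using shrikhande_double[OF s] by blast
    ultimately show ?thesis unfolding M_def by blast
  qed
  have "w \<in> M" for w
    using shrikhande_diff_cases[of "w - p"]
  proof (elim disjE bexE)
    assume "w - p = 0"
    then show ?thesis using p by simp
  next
    assume "w - p \<in> shrikhande_set"
    then have "p + (w - p) \<in> M" using add[OF p] by blast
    then show ?thesis by simp
  next
    fix s assume "s \<in> shrikhande_set" "w - p - s \<in> shrikhande_set"
    then have "(p + s) + (w - p - s) \<in> M" using add p by blast
    then show ?thesis by simp
  qed
  then show ?thesis unfolding M_def by blast
qed

text \<open>Any \<open>t\<close> other than \<open>v\<close> is adjacent to \<open>v\<close> and at
  distance at most 1 from \<open>u\<close>, and 1 is the distance from \<open>u\<close> to
  \<open>v\<close>.\<close>

lemma K4_strongly_closed: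
  assumes uv: "u \<in> Z" "v \<in> Z" "u \<noteq> v"
    and closed: "\<And>u v t. u \<in> Z \<Longrightarrow> v \<in> Z \<Longrightarrow> (v, t) \<in> parcs K4 \<Longrightarrow>
      dist2 K4 u t \<le> dist2 K4 u v \<Longrightarrow> t \<in> Z"
  shows "Z = UNIV"
proof -
  have arc: "(x, y) \<in> parcs K4 \<longleftrightarrow> x \<noteq> y" for x y by (simp add: K4_def complete_graph_def)
  have "t \<in> Z" for t
    using uv closed[OF uv(1,2), of t] by (cases "t = v") (auto simp: dist2_def arc)
  then show ?thesis by blast
qed

text \<open>Pull \<open>Z\<close> back along \<open>f\<close>. The statement for the original graph
  enters as a premise, so one transfer serves both kinds of factors.\<close>

lemma image_graph_strongly_closed:
  assumes f: "inj f" "pverts H = UNIV" and Z: "Z \<subseteq> pverts (image_graph f H)" "u \<in> Z" "v \<in> Z" "u \<noteq> v"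
    and closed: "\<And>u v t. u \<in> Z \<Longrightarrow> v \<in> Z \<Longrightarrow> (v, t) \<in> parcs (image_graph f H) \<Longrightarrow>
      dist2 (image_graph f H) u t \<le> dist2 (image_graph f H) u v \<Longrightarrow> t \<in> Z"
    and H: "\<And>Z u v. u \<in> Z \<Longrightarrow> v \<in> Z \<Longrightarrow> u \<noteq> v \<Longrightarrow>
      (\<And>u v t. u \<in> Z \<Longrightarrow> v \<in> Z \<Longrightarrow> (v, t) \<in> parcs H \<Longrightarrow> dist2 H u t \<le> dist2 H u v \<Longrightarrow> t \<in> Z) \<Longrightarrow>
      Z = UNIV"
  shows "Z = pverts (image_graph f H)"
proof -
  have range: "pverts (image_graph f H) = range f" by (simp add: image_graph_def f)
  then obtain u' v' where uv: "u = f u'" "v = f v'" using Z by blast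
  have "f -` Z = UNIV"
  proof (rule H[of u' _ v'])
    show "u' \<in> f -` Z" "v' \<in> f -` Z" "u' \<noteq> v'" using Z uv by auto
    fix x y t assume *: "x \<in> f -` Z" "y \<in> f -` Z" "(y, t) \<in> parcs H" "dist2 H x t \<le> dist2 H x y"
    have "f t \<in> Z"
    proof (rule closed[of "f x" "f y"])
      show "f x \<in> Z" "f y \<in> Z" using * by auto
      show "(f y, f t) \<in> parcs (image_graph f H)" using *(3) by (auto simp: image_graph_def)
      show "dist2 (image_graph f H) (f x) (f t) \<le> dist2 (image_graph f H) (f x) (f y)"
        using *(4) by (simp add: dist2_image[OF f(1)])
    qed
    then show "t \<in> f -` Z" by simp
  qed
  then have "range f \<subseteq> Z" by (simp only: image_subset_iff_subset_vimage)
  then show ?thesis using Z(1) unfolding range by (rule subset_antisym[rotated])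
qed

section \<open>The Doob graph\<close>

lemma diameter_le_2_doob_factor: "diameter_le_2 (doob_factor d1 i)"
  by (simp add: doob_factor_def diameter_le_2_image diameter_le_2_shrikhande diameter_le_2_K4)

lemma doob_factor_strongly_closed:
  assumes "Z \<subseteq> pverts (doob_factor d1 i)" "u \<in> Z" "v \<in> Z" "u \<noteq> v"
    and closed: "\<And>u v t. u \<in> Z \<Longrightarrow> v \<in> Z \<Longrightarrow> (v, t) \<in> parcs (doob_factor d1 i) \<Longrightarrow>
      dist2 (doob_factor d1 i) u t \<le> dist2 (doob_factor d1 i) u v \<Longrightarrow> t \<in> Z"
  shows "Z = pverts (doob_factor d1 i)"
proof (cases "i \<le> d1")
  case True
  then have eq: "doob_factor d1 i = image_graph Inl shrikhande" by (simp add: doob_factor_def)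
  show ?thesis
    using assms(1-4) closed unfolding eq
    by (rule image_graph_strongly_closed[OF inj_Inl pverts_shrikhande _ _ _ _ _ shrikhande_strongly_closed])
next
  case False
  then have eq: "doob_factor d1 i = image_graph Inr K4" by (simp add: doob_factor_def)
  have K4: "pverts K4 = UNIV" by (simp add: K4_def complete_graph_def)
  show ?thesis
    using assms(1-4) closed unfolding eq
    by (rule image_graph_strongly_closed[OF inj_Inr K4 _ _ _ _ _ K4_strongly_closed])
qed

theorem mainTheorem10:
  fixes d1 d2 :: nat
    and E :: "nat \<Rightarrow> (nat \<Rightarrow> (4 \<times> 4) + 4) cmat"
    and Y :: "(nat \<Rightarrow> (4 \<times> 4) + 4) set"
  assumes "d1 \<ge> 1" and "d2 \<ge> 1"
    and "standard_ordering (doob d1 d2) (2 * d1 + d2) 1 0 3 E"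
    and "descendent (doob d1 d2) E Y"
  shows "\<exists>Z :: nat \<Rightarrow> ((4 \<times> 4) + 4) set.
           Y = (\<Pi>\<^sub>E i\<in>{1..d1 + d2}. Z i) \<and>
           (\<forall>i\<in>{1..d1 + d2}. Z i \<subseteq> pverts (doob_factor d1 i) \<and>
              (Z i = pverts (doob_factor d1 i) \<or> card (Z i) = 1))"
proof -
  let ?I = "{1..d1 + d2}" and ?H = "doob_factor d1"
  have doob: "doob d1 d2 = cartesian_product ?I ?H" by (simp add: doob_def)
  \<comment> \<open>Having classical parameters includes being a graph, which supplies
    \<open>pg\<close>.\<close>
  have "has_classical_parameters (doob d1 d2) (2 * d1 + d2) 1 0 3"
    using assms(3) unfolding standard_ordering_def by (elim conjE)
  then have pg: "pair_graph (cartesian_product ?I ?H)"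
    unfolding doob has_classical_parameters_def has_intersection_numbers_def by (elim conjE exE)
  \<comment> \<open>All factors have diameter at most two, so \<open>dist2\<close> serves as their
    distance function.\<close>
  interpret product_distance ?I ?H "\<lambda>i. dist2 (?H i)"
    by (rule product_distance.intro; (rule finite_atLeastAtMost | rule pg |
      erule dist2_step | erule (2) diameter_le_2_descend[OF diameter_le_2_doob_factor] | simp add: dist2_def))
  have Y: "Y \<subseteq> V" "Y \<noteq> {}"
    using assms(4) unfolding descendent_def doob pverts_product by auto
  have closed: "z \<in> Y" if "x \<in> Y" "y \<in> Y" "(y, z) \<in> parcs (cartesian_product ?I ?H)"
    "graph_dist (cartesian_product ?I ?H) x z \<le> graph_dist (cartesian_product ?I ?H) x y" for x y z
    using descendent_strongly_closed[of "doob d1 d2" "2 * d1 + d2" 3 E Y x y z] assms that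
    unfolding doob by simp
  have "\<exists>Z. Y = (\<Pi>\<^sub>E i\<in>?I. Z i) \<and> (\<forall>i\<in>?I. Z i \<noteq> {} \<and> Z i \<subseteq> pverts (?H i) \<and>
    (\<forall>u\<in>Z i. \<forall>v\<in>Z i. \<forall>t\<in>pverts (?H i). (v, t) \<in> parcs (?H i) \<longrightarrow>
      dist2 (?H i) u t \<le> dist2 (?H i) u v \<longrightarrow> t \<in> Z i))"
    by (rule strongly_closed_product[OF Y]) (fact closed)
  then obtain Z where YZ: "Y = (\<Pi>\<^sub>E i\<in>?I. Z i)" and Z: "\<forall>i\<in>?I. Z i \<noteq> {} \<and> Z i \<subseteq> pverts (?H i) \<and>
    (\<forall>u\<in>Z i. \<forall>v\<in>Z i. \<forall>t\<in>pverts (?H i). (v, t) \<in> parcs (?H i) \<longrightarrow>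
      dist2 (?H i) u t \<le> dist2 (?H i) u v \<longrightarrow> t \<in> Z i)"
    by (elim exE conjE) (rule that)
  \<comment> \<open>Two distinct points of a projection force the whole factor; otherwise the
    nonempty projection is a singleton.\<close>
  have "Z i = pverts (?H i) \<or> card (Z i) = 1" if i: "i \<in> ?I" for i
  proof (cases "\<exists>u\<in>Z i. \<exists>v\<in>Z i. u \<noteq> v")
    case True
    then obtain u v where uv: "u \<in> Z i" "v \<in> Z i" "u \<noteq> v" by blast
    have "Z i = pverts (?H i)"
    proof (rule doob_factor_strongly_closed[OF _ uv])
      show "Z i \<subseteq> pverts (?H i)" using Z i by blast
      fix u v t assume *: "u \<in> Z i" "v \<in> Z i" "(v, t) \<in> parcs (?H i)"
        "dist2 (?H i) u t \<le> dist2 (?H i) u v"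
      then have "t \<in> pverts (?H i)"
        using diameter_le_2_doob_factor[of d1 i] unfolding diameter_le_2_def by fast
      then show "t \<in> Z i" using Z[rule_format, OF i] * by blast
    qed
    then show ?thesis by blast
  next
    case False
    then obtain u where "Z i = {u}" using Z[rule_format, OF i] by blast
    then show ?thesis by simp
  qed
  then show ?thesis using Z by (intro exI[of _ Z] conjI YZ) blast
qed

end
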